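(* Let $\varphi(r)=r^2\log r$ for $r>0$, $\varphi(0)=0$, be the thin-plate spline radial basis function. For $j\in\mathbb{Z}$ let $$\lambda_j=\frac{1}{2\pi}\cdot\frac{1}{2\pi}\int_{-\pi}^{\pi}(2-2\cos\vartheta)^{3/2}\,e^{i\vartheta j}\,d\vartheta,$$ i.e. the $\lambda_j$ are the Fourier coefficients of $(2-2\cos\vartheta)^{3/2}$ multiplied by the normalising factor $\frac1{2\pi}$, and let $$\psi(x)=\sum_{j\in\mathbb{Z}}\lambda_j\,\varphi(|x-j|),\qquad x\in\mathbb{R}.$$ Then quasi-interpolation with $\psi$ is exact for linear polynomials: for every polynomial $p$ of degree at most $1$, $$\sum_{k\in\mathbb{Z}}p(k)\,\psi(x-k)=p(x)\qquad\text{for all }x\in\mathbb{R}.$$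
   Context: The space dimension is $n=1$. The function $\psi$ is called the quasi-Lagrange function formed from integer shifts of the radial basis function $\varphi(|\cdot|)$ with coefficients $\lambda_j$. The Fourier transform convention is $\hat f(\xi)=\int_{\mathbb{R}} f(x)e^{-i\xi x}\,dx$. *)

theory Defs
  imports "HOL-Analysis.Analysis" "HOL-Computational_Algebra.Polynomial"
begin

definition thin_plate :: "real \<Rightarrow> real" where
  "thin_plate r = (if r > 0 then r\<^sup>2 * ln r else 0)"

text \<open>
  The coefficients are kept complex, as the integrand is; their being real is not built in.
  The symbol is continuous and vanishes at 0, in accordance with \<open>0 powr a = 0\<close>.
\<close>

definition tps_coeff :: "int \<Rightarrow> complex" where
  "tps_coeff j = 1 / (2 * of_real pi) * (1 / (2 * of_real pi) *
     integral {-pi..pi} (\<lambda>\<theta>::real.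
       of_real ((2 - 2 * cos \<theta>) powr (3/2)) * exp (\<i> * of_real \<theta> * of_int j)))"

text \<open>
  The doubly infinite series converges absolutely, because the coefficients are
  of order \<open>\<bar>j\<bar>\<close> to the power -4, so unordered summation is the usual one here.
\<close>

definition quasi_lagrange :: "real \<Rightarrow> complex" where
  "quasi_lagrange x =
     (\<Sum>\<^sub>\<infinity>j\<in>(UNIV :: int set). tps_coeff j * of_real (thin_plate \<bar>x - of_int j\<bar>))"

end

theory Submission
  imports Defs "HOL-Real_Asymp.Real_Asymp"
begin

text \<open>
Write \<open>third_diff g z = g (z + 3/2) - 3 g (z + 1/2) + 3 g (z - 1/2) - g (z - 3/2)\<close>. Formally the
Fourier transform of \<open>x\<^sup>2 ln \<bar>x\<bar>\<close> is \<open>2 \<pi> / \<bar>\<xi>\<bar>\<^sup>3\<close>, so that of the quasi-Lagrange function \<open>\<psi>\<close> is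
\<open>\<bar>2 sin (\<xi>/2) / \<xi>\<bar>\<^sup>3\<close>, which is 1 at the origin and vanishes to third order at the other
multiples of \<open>2 \<pi>\<close>; this is why linear polynomials are reproduced. The proof below avoids
distributions and Poisson summation and makes the cancellation explicit through telescoping sums.

\<^item> The symbol \<open>\<bar>2 sin (\<theta>/2)\<bar>\<^sup>3\<close> equals \<open>6 sin (\<theta>/2) - 2 sin (3\<theta>/2)\<close> on \<open>[0, \<pi>]\<close>, so its Fourier
  coefficients are rational in \<open>j\<close>: \<open>\<lambda>\<^sub>j = - third_diff inverse j / (2 \<pi>\<^sup>2)\<close>, see \<open>tps_coeff_eq\<close>.

\<^item> Up to a quadratic polynomial in \<open>y\<close>, which summation against the \<open>\<lambda>\<^sub>j\<close> annihilates, \<open>y\<^sup>2 ln \<bar>y\<bar>\<close> is the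
  superposition of the kernels \<open>s\<^sup>3 / (y\<^sup>2 + s\<^sup>2) = - s\<^sup>2 Im (1 / (y + i s))\<close> over \<open>s > 0\<close>. With
  \<open>z = x + i s\<close>, the sum over the lattice turns into the partial fraction series of
  \<open>\<pi> cot (\<pi> z)\<close>, and \<open>\<psi> x\<close> is the integral of \<open>s\<^sup>2 Im (cot (\<pi> z) third_diff inverse z) / (2 \<pi>)\<close>
  over \<open>s > 0\<close>, see \<open>quasi_lagrange_eq_lagrange_integral\<close>.

\<^item> In the upper half-plane \<open>cot (\<pi> z)\<close> is \<open>- i\<close> plus an exponentially small function of period 1.
  The constant \<open>- i\<close> contributes \<open>third_diff (\<lambda>y. y \<bar>y\<bar>) x / 4\<close>, the centred quadratic B-spline, whose
  shifts reproduce linear polynomials. In the other part the periodic factor comes out of a sum over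
  shifts, and what remains are the sums of \<open>third_diff inverse (z - k)\<close> and of
  \<open>(z - k) third_diff inverse (z - k)\<close>; both telescope to 0. So this part, which decays like
  \<open>x\<^sup>-\<^sup>4\<close>, contributes nothing to the moments of order 0 and 1.

Hence \<open>\<psi> (x - k)\<close> sums to 1 and \<open>(x - k) \<psi> (x - k)\<close> sums to 0 over \<open>k\<close>, and
\<open>a + b k = (a + b x) - b (x - k)\<close> gives the claim.
\<close>

section \<open>Summation over the integers by symmetric windows\<close>

lemma filterlim_int_windows:
  "filterlim (\<lambda>N. {- int N..int N}) (finite_subsets_at_top UNIV) sequentially"
  unfolding filterlim_finite_subsets_at_top
proof (intro allI impI)
  fix X :: "int set" assume "finite X \<and> X \<subseteq> UNIV"
  then have fin: "finite X" by simp
  define m where "m = (\<Sum>k\<in>X. nat \<bar>k\<bar>)"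
  have le: "nat \<bar>k\<bar> \<le> m" if "k \<in> X" for k
    unfolding m_def using fin that by (intro member_le_sum) auto
  show "\<forall>\<^sub>F N in sequentially. finite {- int N..int N} \<and> X \<subseteq> {- int N..int N} \<and> {- int N..int N} \<subseteq> UNIV"
    using eventually_ge_at_top[of m]
  proof eventually_elim
    case (elim N)
    show ?case using le elim by fastforce
  qed
qed

lemma summable_on_int_if_summable_tails:
  fixes f :: "int \<Rightarrow> 'a::banach"
  assumes "summable (\<lambda>n. norm (f (int n)))" "summable (\<lambda>n. norm (f (- int n)))"
  shows "f summable_on UNIV"
proof -
  have *: "(\<lambda>k. norm (f k)) summable_on range g"
    if "inj g" "summable (\<lambda>n. norm (f (g n)))" for g :: "nat \<Rightarrow> int"
  proof -
    have "(\<lambda>n. norm (f (g n))) summable_on UNIV"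
      using that(2) by (intro norm_summable_imp_summable_on) simp
    then have "((\<lambda>k. norm (f k)) \<circ> g) summable_on UNIV"
      by (simp only: o_def)
    then show ?thesis
      using summable_on_reindex[OF that(1)] by blast
  qed
  have cover: "range int \<union> range (\<lambda>n. - int n) = UNIV"
  proof -
    have "k \<in> range int \<union> range (\<lambda>n. - int n)" for k
      by (cases k rule: int_cases2) auto
    then show ?thesis by blast
  qed
  have "(\<lambda>k. norm (f k)) summable_on range int"
    by (rule *) (use assms in \<open>auto simp: inj_def\<close>)
  moreover have "(\<lambda>k. norm (f k)) summable_on range (\<lambda>n. - int n)"
    by (rule *) (use assms in \<open>auto simp: inj_def\<close>)
  ultimately have "(\<lambda>k. norm (f k)) summable_on UNIV"
    using summable_on_union[of _ "range int" "range (\<lambda>n. - int n)"] cover by simp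
  then show ?thesis
    by (rule abs_summable_summable)
qed

text \<open>
Once unconditional summability is known, the value of a sum may be computed along any sequence of
finite sets that exhausts the integers. Symmetric windows are the right choice here because the
cotangent series converges only in this sense and because differences telescope over them.
\<close>

lemma has_sum_int_window_limit:
  fixes f :: "int \<Rightarrow> 'a::{t2_space,comm_monoid_add}"
  assumes "f summable_on UNIV" "(\<lambda>N. \<Sum>k=-int N..int N. f k) \<longlonglongrightarrow> L"
  shows "(f has_sum L) UNIV"
proof -
  obtain L' where L': "(f has_sum L') UNIV"
    using assms(1) by (auto simp: summable_on_def)
  have "(\<lambda>N. \<Sum>k=-int N..int N. f k) \<longlonglongrightarrow> L'"
    using filterlim_compose[OF L'[unfolded has_sum_def] filterlim_int_windows] .
  then show ?thesis using assms(2) L' LIMSEQ_unique by blast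
qed

lemma window_sum_Suc:
  fixes f :: "int \<Rightarrow> 'a::comm_monoid_add"
  shows "(\<Sum>k=-int (Suc N)..int (Suc N). f k)
    = (\<Sum>k=-int N..int N. f k) + (f (int (Suc N)) + f (- int (Suc N)))"
proof -
  have "{-int (Suc N)..int (Suc N)} = insert (int (Suc N)) (insert (- int (Suc N)) {-int N..int N})"
    by auto
  then show ?thesis by (simp add: ac_simps)
qed

section \<open>Telescoping of third differences\<close>

lemma telescope_window:
  fixes V :: "'a::real_normed_field \<Rightarrow> 'b::ab_group_add"
  shows "(\<Sum>k=-int N..int N. V (z - of_int k + 1/2) - V (z - of_int k - 1/2))
    = V (z + of_nat N + 1/2) - V (z - of_nat N - 1/2)"
proof (induction N)
  case (Suc N)
  have "z - 1 - of_nat N + 1/2 = z - of_nat N - 1/2" "z + 1 + of_nat N - 1/2 = z + of_nat N + 1/2"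
    by (simp_all add: field_simps)
  then show ?case
    unfolding window_sum_Suc Suc by (simp add: algebra_simps)
qed simp

definition third_diff :: "('a::real_normed_field \<Rightarrow> 'a) \<Rightarrow> 'a \<Rightarrow> 'a" where
  "third_diff g z = g (z + 3/2) - 3 * g (z + 1/2) + 3 * g (z - 1/2) - g (z - 3/2)"

definition second_diff :: "('a::real_normed_field \<Rightarrow> 'a) \<Rightarrow> 'a \<Rightarrow> 'a" where
  "second_diff g v = g (v + 1) - 2 * g v + g (v - 1)"

text \<open>
Discrete analogue of \<open>v g''(v) - g'(v)\<close>, the antiderivative of \<open>v g'''(v)\<close>.
\<close>

definition moment_diff :: "('a::real_normed_field \<Rightarrow> 'a) \<Rightarrow> 'a \<Rightarrow> 'a" where
  "moment_diff g v = v * second_diff g v - (g (v + 1) - g (v - 1)) / 2"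

lemma third_diff_window:
  fixes g :: "'a::real_normed_field \<Rightarrow> 'a"
  shows "(\<Sum>k=-int N..int N. third_diff g (z - of_int k))
    = second_diff g (z + of_nat N + 1/2) - second_diff g (z - of_nat N - 1/2)"
proof -
  have "third_diff g u = second_diff g (u + 1/2) - second_diff g (u - 1/2)" for u
  proof -
    have e: "u + 1/2 + 1 = u + 3/2" "u - 1/2 - 1 = u - 3/2" "u + 1/2 - 1 = u - 1/2" "u - 1/2 + 1 = u + 1/2"
      by (simp_all add: field_simps)
    show ?thesis unfolding third_diff_def second_diff_def e by (simp add: algebra_simps)
  qed
  then show ?thesis using telescope_window[of "second_diff g" z N] by simp
qed

lemma third_diff_moment_window:
  fixes g :: "'a::real_normed_field \<Rightarrow> 'a"
  shows "(\<Sum>k=-int N..int N. (z - of_int k) * third_diff g (z - of_int k))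
    = moment_diff g (z + of_nat N + 1/2) - moment_diff g (z - of_nat N - 1/2)"
proof -
  have "u * third_diff g u = moment_diff g (u + 1/2) - moment_diff g (u - 1/2)" for u
  proof -
    have e: "u + 1/2 + 1 = u + 3/2" "u - 1/2 - 1 = u - 3/2" "u + 1/2 - 1 = u - 1/2" "u - 1/2 + 1 = u + 1/2"
      by (simp_all add: field_simps)
    have alg: "u * (a - 3 * b + 3 * c - d)
      = (u + 1/2) * (a - 2 * b + c) - (a - c) / 2 - ((u - 1/2) * (b - 2 * c + d) - (b - d) / 2)"
      for a b c d :: 'a
      by (simp add: field_simps)
    show ?thesis unfolding third_diff_def second_diff_def moment_diff_def e by (rule alg)
  qed
  then show ?thesis using telescope_window[of "moment_diff g" z N] by simp
qed

section \<open>Third differences of the reciprocal\<close>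

lemma third_diff_inverse:
  fixes z :: "'a::real_normed_field"
  assumes "z + 3/2 \<noteq> 0" "z + 1/2 \<noteq> 0" "z - 1/2 \<noteq> 0" "z - 3/2 \<noteq> 0"
  shows "third_diff inverse z = - 6 / ((z + 3/2) * (z + 1/2) * (z - 1/2) * (z - 3/2))"
proof -
  define b where "b = z - 3/2"
  have e: "z - 3/2 = b" "z - 1/2 = b + 1" "z + 1/2 = b + 2" "z + 3/2 = b + 3"
    by (simp_all add: b_def field_simps)
  have "inverse (b + 3) - 3 * inverse (b + 2) + 3 * inverse (b + 1) - inverse b
     = - 6 / ((b + 3) * (b + 2) * (b + 1) * b)"
    using assms unfolding e
    by (simp add: divide_simps) (simp add: algebra_simps)
  then show ?thesis unfolding third_diff_def e .
qed

text \<open>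
Third differences at an integer only evaluate \<open>inverse\<close> at half-odd numbers, so the default value
\<open>inverse 0 = 0\<close> never enters the coefficients.
\<close>

lemma int_plus_half_odd_nonzero:
  fixes j :: int
  shows "of_int j + 3/2 \<noteq> (0::'a::field_char_0)" "of_int j + 1/2 \<noteq> (0::'a)"
    "of_int j - 1/2 \<noteq> (0::'a)" "of_int j - 3/2 \<noteq> (0::'a)"
proof -
  have *: "of_int j + of_int m / 2 \<noteq> (0::'a)" if "odd m" for m :: int
  proof
    assume "of_int j + of_int m / 2 = (0::'a)"
    then have "of_int (2 * j + m) = (0::'a)" by (simp add: field_simps)
    then have "2 * j + m = 0" by (simp only: of_int_eq_0_iff)
    then show False using that by presburger
  qed
  show "of_int j + 3/2 \<noteq> (0::'a::field_char_0)" "of_int j + 1/2 \<noteq> (0::'a)"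
    "of_int j - 1/2 \<noteq> (0::'a)" "of_int j - 3/2 \<noteq> (0::'a)"
    using *[of 3] *[of 1] *[of "-1"] *[of "-3"] by simp_all
qed

lemma norm_add_of_real_ge:
  fixes z :: complex
  assumes "\<bar>Re z\<bar> \<ge> r + \<bar>a\<bar>"
  shows "norm (z + of_real a) \<ge> r"
  using abs_Re_le_cmod[of "z + of_real a"] assms by simp

lemma norm_third_diff_inverse_le:
  fixes z :: complex
  assumes r: "r > 0" "\<bar>Re z\<bar> \<ge> r + 3/2"
  shows "norm (third_diff inverse z) \<le> 6 / r ^ 4"
proof -
  have n: "norm (z + 3/2) \<ge> r" "norm (z + 1/2) \<ge> r" "norm (z - 1/2) \<ge> r" "norm (z - 3/2) \<ge> r"
    using norm_add_of_real_ge[of r "3/2" z] norm_add_of_real_ge[of r "1/2" z]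
      norm_add_of_real_ge[of r "- (1/2)" z] norm_add_of_real_ge[of r "- (3/2)" z] r by simp_all
  have "w \<noteq> 0" if "norm w \<ge> r" for w :: complex using that r by auto
  note nz = n[THEN this]
  have "norm ((z + 3/2) * (z + 1/2) * (z - 1/2) * (z - 3/2)) \<ge> r * r * r * r"
    unfolding norm_mult using n r by (intro mult_mono) auto
  then have "6 / norm ((z + 3/2) * (z + 1/2) * (z - 1/2) * (z - 3/2)) \<le> 6 / (r * r * r * r)"
    using r nz by (intro divide_left_mono) auto
  moreover have "r * r * r * r = r ^ 4" by (simp add: eval_nat_numeral)
  ultimately show ?thesis
    unfolding third_diff_inverse[OF nz] norm_divide by simp
qed

lemma differences_of_inverse:
  fixes v :: complex
  assumes "v \<noteq> 0" "v + 1 \<noteq> 0" "v - 1 \<noteq> 0"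
  shows "second_diff inverse v = 2 / ((v + 1) * v * (v - 1))"
    and "moment_diff inverse v = 3 / ((v + 1) * (v - 1))"
proof -
  show 1: "second_diff inverse v = 2 / ((v + 1) * v * (v - 1))"
    unfolding second_diff_def using assms by (simp add: divide_simps) (simp add: algebra_simps)
  have "inverse (v + 1) - inverse (v - 1) = - 2 / ((v + 1) * (v - 1))"
    using assms by (simp add: divide_simps)
  then show "moment_diff inverse v = 3 / ((v + 1) * (v - 1))"
    unfolding moment_diff_def 1 using assms by (simp add: divide_simps)
qed

text \<open>
Bounds for the boundary terms of the telescoping sums. They depend on the real part only, hence are
uniform along vertical lines. The second one compensates the factor \<open>Im v\<close> that is left over when
the real weight \<open>x - k\<close> is replaced by the complex weight \<open>z - k\<close>; it uses that
\<open>second_diff inverse v\<close> decays one order faster than the bound \<open>r\<^sup>-\<^sup>2\<close>.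
\<close>

lemma norm_differences_of_inverse_le:
  fixes v :: complex
  assumes r: "r \<ge> 1" "\<bar>Re v\<bar> \<ge> r + 1"
  shows "norm (second_diff inverse v) \<le> 2 / r\<^sup>2"
    and "\<bar>Im v\<bar> * norm (second_diff inverse v) \<le> 2 / r\<^sup>2"
    and "norm (moment_diff inverse v) \<le> 3 / r\<^sup>2"
proof -
  have n: "norm (v + 1) \<ge> r" "norm v \<ge> r" "norm (v - 1) \<ge> r"
    using norm_add_of_real_ge[of r 1 v] norm_add_of_real_ge[of r 0 v] norm_add_of_real_ge[of r "- 1" v] r by simp_all
  then have nz: "v \<noteq> 0" "v + 1 \<noteq> 0" "v - 1 \<noteq> 0" using r by auto
  have q: "norm ((v + 1) * (v - 1)) \<ge> r\<^sup>2"
    unfolding norm_mult power2_eq_square using n r by (intro mult_mono) auto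
  have qp: "r\<^sup>2 > 0" using r by simp
  have c: "c / norm ((v + 1) * (v - 1)) \<le> c / r\<^sup>2" if "c \<ge> 0" for c
    using q qp that by (intro divide_left_mono mult_pos_pos) (auto intro: less_le_trans)
  have s: "norm (second_diff inverse v) = 2 / norm ((v + 1) * (v - 1)) / norm v"
    unfolding differences_of_inverse(1)[OF nz] by (simp add: norm_divide norm_mult)
  have frac: "a * (2 / norm ((v + 1) * (v - 1)) / norm v) \<le> 2 / r\<^sup>2" if "0 \<le> a" "a \<le> norm v" for a
  proof -
    have "a * (2 / norm ((v + 1) * (v - 1)) / norm v) = 2 / norm ((v + 1) * (v - 1)) * (a / norm v)" by simp
    also have "\<dots> \<le> 2 / norm ((v + 1) * (v - 1)) * 1"
      using that nz(1) by (intro mult_left_mono) (auto simp: field_simps)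
    also have "\<dots> \<le> 2 / r\<^sup>2" using c[of 2] by simp
    finally show ?thesis .
  qed
  show "norm (second_diff inverse v) \<le> 2 / r\<^sup>2" unfolding s using frac[of 1] n r by simp
  show "\<bar>Im v\<bar> * norm (second_diff inverse v) \<le> 2 / r\<^sup>2"
    unfolding s by (intro frac abs_Im_le_cmod) simp
  show "norm (moment_diff inverse v) \<le> 3 / r\<^sup>2"
    unfolding differences_of_inverse(2)[OF nz] using c[of 3] by (simp add: norm_divide)
qed

section \<open>The coefficients of the quasi-Lagrange function\<close>

lemma symbol_eq:
  fixes t :: real
  assumes "sin (t/2) \<ge> 0"
  shows "(2 - 2 * cos t) powr (3/2) = 6 * sin (1/2 * t) - 2 * sin (3/2 * t)"
proof -
  have "2 - 2 * cos t = (2 * sin (t/2))\<^sup>2"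
    using cos_double_sin[of "t/2"] by (simp add: power2_eq_square)
  then have "(2 - 2 * cos t) powr (3/2) = (2 * sin (t/2)) ^ 3"
  proof (cases "sin (t/2) = 0")
    case False
    then have pos: "2 * sin (t/2) > 0" using assms by simp
    have "((2 * sin (t/2))\<^sup>2) powr (3/2) = ((2 * sin (t/2)) powr 2) powr (3/2)"
      using pos by (simp add: powr_numeral)
    also have "\<dots> = (2 * sin (t/2)) powr 3" by (simp add: powr_powr)
    also have "\<dots> = (2 * sin (t/2)) ^ 3" using pos by (simp add: powr_numeral)
    finally show ?thesis using \<open>2 - 2 * cos t = _\<close> by simp
  qed simp
  moreover have "sin (3/2 * t) = 3 * sin (t/2) - 4 * sin (t/2) ^ 3"
  proof -
    have "3/2 * t = t/2 + t/2 + t/2" by simp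
    then have "sin (3/2 * t) = sin (t/2 + t/2 + t/2)" by (rule arg_cong)
    also have "\<dots> = 3 * sin (t/2) * (cos (t/2))\<^sup>2 - sin (t/2) ^ 3"
      by (simp only: sin_add cos_add) (simp add: algebra_simps power2_eq_square power3_eq_cube)
    also have "\<dots> = 3 * sin (t/2) - 4 * sin (t/2) ^ 3"
      unfolding cos_squared_eq by (simp add: algebra_simps power2_eq_square power3_eq_cube)
    finally show ?thesis .
  qed
  ultimately show ?thesis by (simp add: power_mult_distrib)
qed

text \<open>
An antiderivative of \<open>sin (a z) exp (i j z)\<close>. It is taken in the complex variable so that the usual
rules of differentiation apply.
\<close>

definition osc_antideriv :: "int \<Rightarrow> real \<Rightarrow> complex \<Rightarrow> complex" where
  "osc_antideriv j a z = exp (\<i> * z * of_int j)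
     * (\<i> * of_int j * sin (of_real a * z) - of_real a * cos (of_real a * z)) / of_real (a\<^sup>2 - (of_int j)\<^sup>2)"

lemma osc_antideriv_has_field_derivative:
  assumes "a\<^sup>2 \<noteq> (of_int j)\<^sup>2"
  shows "(osc_antideriv j a has_field_derivative
     sin (of_real a * z) * exp (\<i> * z * of_int j)) (at z)"
proof -
  have nz: "of_real (a\<^sup>2 - (of_int j)\<^sup>2) \<noteq> (0::complex)"
    using assms by (simp only: of_real_eq_0_iff)
  show ?thesis
    unfolding osc_antideriv_def [abs_def]
    by (rule derivative_eq_intros refl nz | simp)+
      (use nz in \<open>simp add: field_simps power2_eq_square\<close>)
qed

lemma exp_ii_pi_int_minus: "exp (\<i> * of_real (- pi) * of_int j) = exp (\<i> * of_real pi * of_int j)"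
proof -
  have "\<i> * of_real pi * of_int j = \<i> * of_real (- pi) * of_int j + of_real (2 * of_int j * pi) * \<i>"
    by (simp add: algebra_simps)
  moreover have "exp (of_real (2 * of_int j * pi) * \<i>) = 1"
    using exp_integer_2pi[of "of_int j"] by simp
  ultimately show ?thesis
    by (simp only: exp_add mult_1_right)
qed

definition symbol_antideriv :: "int \<Rightarrow> real \<Rightarrow> complex" where
  "symbol_antideriv j t = 6 * osc_antideriv j (1/2) (of_real t) - 2 * osc_antideriv j (3/2) (of_real t)"

lemma half_odd_squared_neq:
  "(1/2)\<^sup>2 \<noteq> (real_of_int j)\<^sup>2" "(3/2)\<^sup>2 \<noteq> (real_of_int j)\<^sup>2"
  using int_plus_half_odd_nonzero[of j, where ?'a = real]
  by (simp_all add: power2_eq_iff del: power_divide power_one)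

lemma symbol_antideriv_has_vector_derivative:
  "(symbol_antideriv j has_vector_derivative
     of_real (6 * sin (1/2 * t) - 2 * sin (3/2 * t)) * exp (\<i> * of_real t * of_int j)) (at t within S)"
proof -
  have "((\<lambda>z. 6 * osc_antideriv j (1/2) z - 2 * osc_antideriv j (3/2) z) has_field_derivative
     6 * (sin (of_real (1/2) * of_real t) * exp (\<i> * of_real t * of_int j))
     - 2 * (sin (of_real (3/2) * of_real t) * exp (\<i> * of_real t * of_int j))) (at (of_real t))"
    by (intro DERIV_diff DERIV_cmult osc_antideriv_has_field_derivative half_odd_squared_neq)
  then have "((\<lambda>t. 6 * osc_antideriv j (1/2) (of_real t) - 2 * osc_antideriv j (3/2) (of_real t))
     has_vector_derivative
     6 * (sin (of_real (1/2) * of_real t) * exp (\<i> * of_real t * of_int j))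
     - 2 * (sin (of_real (3/2) * of_real t) * exp (\<i> * of_real t * of_int j))) (at t within S)"
    by (rule has_vector_derivative_real_field)
  moreover have "6 * (sin (of_real (1/2) * of_real t) * exp (\<i> * of_real t * of_int j))
     - 2 * (sin (of_real (3/2) * of_real t) * exp (\<i> * of_real t * of_int j))
     = of_real (6 * sin (1/2 * t) - 2 * sin (3/2 * t)) * exp (\<i> * of_real t * of_int j)"
    by (simp only: of_real_diff of_real_mult of_real_numeral sin_of_real flip: of_real_mult)
       (simp add: algebra_simps)
  ultimately show ?thesis unfolding symbol_antideriv_def [abs_def] by simp
qed

text \<open>
The values at the two end points cancel because the periodic symbol is smooth there. Its third
derivative jumps at 0, and this jump alone determines the coefficients.
\<close>

lemma symbol_antideriv_values:
  "symbol_antideriv j pi + symbol_antideriv j (- pi) = 0"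
  "symbol_antideriv j 0 = of_real (third_diff inverse (of_int j))"
proof -
  have c: "cos (of_real (1/2) * of_real pi :: complex) = 0" "cos (of_real (3/2) * of_real pi :: complex) = 0"
  proof -
    have c3: "cos (3/2 * pi) = 0" using cos_3over2_pi by simp
    have eq: "cos (of_real a * of_real pi :: complex) = of_real (cos (a * pi))" for a
      by (simp only: cos_of_real flip: of_real_mult)
    show "cos (of_real (1/2) * of_real pi :: complex) = 0"
      unfolding eq by simp
    show "cos (of_real (3/2) * of_real pi :: complex) = 0"
      unfolding eq c3 by simp
  qed
  have m: "osc_antideriv j a (of_real pi) + osc_antideriv j a (of_real (- pi)) = 0"
    if "cos (of_real a * of_real pi :: complex) = 0" for a
    using that exp_ii_pi_int_minus[of j] unfolding osc_antideriv_def
    by (simp add: algebra_simps add_divide_distrib[symmetric])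
  show "symbol_antideriv j pi + symbol_antideriv j (- pi) = 0"
    using m[OF c(1)] m[OF c(2)] unfolding symbol_antideriv_def
    by (simp add: algebra_simps) algebra
  have d: "(real_of_int j + 3/2) * (real_of_int j - 3/2) \<noteq> 0"
      "(real_of_int j + 1/2) * (real_of_int j - 1/2) \<noteq> 0"
    using int_plus_half_odd_nonzero[of j, where ?'a = real] by auto
  have "symbol_antideriv j 0 = of_real (- 3 / ((1/2)\<^sup>2 - (real_of_int j)\<^sup>2) + 3 / ((3/2)\<^sup>2 - (real_of_int j)\<^sup>2))"
  proof -
    have "osc_antideriv j a 0 = of_real (- a / (a\<^sup>2 - (real_of_int j)\<^sup>2))" for a
      unfolding osc_antideriv_def by simp
    moreover have "of_real (- 3 / A + 3 / B) = 6 * complex_of_real (- (1/2) / A) - 2 * of_real (- (3/2) / B)"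
      for A B :: real
      by simp
    ultimately show ?thesis
      unfolding symbol_antideriv_def by (simp only: of_real_0)
  qed
  also have "(1/2)\<^sup>2 - (real_of_int j)\<^sup>2 = - ((real_of_int j + 1/2) * (real_of_int j - 1/2))"
    by (simp add: field_simps power2_eq_square)
  also have "(3/2)\<^sup>2 - (real_of_int j)\<^sup>2 = - ((real_of_int j + 3/2) * (real_of_int j - 3/2))"
    by (simp add: field_simps power2_eq_square)
  also have "- 3 / - ((real_of_int j + 1/2) * (real_of_int j - 1/2)) + 3 / - ((real_of_int j + 3/2) * (real_of_int j - 3/2))
     = - 6 / (((real_of_int j + 3/2) * (real_of_int j - 3/2)) * ((real_of_int j + 1/2) * (real_of_int j - 1/2)))"
  proof -
    have "(real_of_int j + 3/2) * (real_of_int j - 3/2) = (real_of_int j + 1/2) * (real_of_int j - 1/2) - 2"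
      by (simp add: field_simps)
    then show ?thesis using d
      by (simp add: divide_simps)
  qed
  also have "\<dots> = third_diff inverse (of_int j)"
    using int_plus_half_odd_nonzero[of j, where ?'a = real] by (subst third_diff_inverse) (simp_all add: mult_ac)
  finally show "symbol_antideriv j 0 = of_real (third_diff inverse (of_int j))" .
qed

text \<open>
On \<open>[-\<pi>, 0]\<close> the symbol is the negative of the trigonometric polynomial that represents it on
\<open>[0, \<pi>]\<close>, so the fundamental theorem is applied to the two halves separately.
\<close>

lemma tps_coeff_eq: "tps_coeff j = of_real (- third_diff inverse (of_int j) / (2 * pi\<^sup>2))"
proof -
  let ?f = "\<lambda>\<theta>::real. complex_of_real ((2 - 2 * cos \<theta>) powr (3/2)) * exp (\<i> * of_real \<theta> * of_int j)"
  let ?g = "\<lambda>\<theta>::real. complex_of_real (6 * sin (1/2 * \<theta>) - 2 * sin (3/2 * \<theta>)) * exp (\<i> * of_real \<theta> * of_int j)"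
  have g: "(?g has_integral symbol_antideriv j b - symbol_antideriv j a) {a..b}" if "a \<le> b" for a b
    by (rule fundamental_theorem_of_calculus[OF that]) (rule symbol_antideriv_has_vector_derivative)
  have "(?f has_integral symbol_antideriv j pi - symbol_antideriv j 0) {0..pi}"
  proof (rule has_integral_eq[OF _ g])
    fix t assume "t \<in> {0..pi}"
    then have "sin (t/2) \<ge> 0" by (intro sin_ge_zero) auto
    then show "?g t = ?f t" by (simp only: symbol_eq)
  qed simp
  moreover have "(?f has_integral - (symbol_antideriv j 0 - symbol_antideriv j (- pi))) {-pi..0}"
  proof (rule has_integral_eq[OF _ has_integral_neg[OF g]])
    fix t assume t: "t \<in> {-pi..0}"
    then have "sin (- t/2) \<ge> 0" by (intro sin_ge_zero) auto
    then have "(2 - 2 * cos (- t)) powr (3/2) = 6 * sin (1/2 * (- t)) - 2 * sin (3/2 * (- t))"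
      by (rule symbol_eq)
    then have "(2 - 2 * cos t) powr (3/2) = - (6 * sin (1/2 * t) - 2 * sin (3/2 * t))"
      by simp
    then show "- ?g t = ?f t" by (simp only: of_real_minus mult_minus_left)
  qed simp
  ultimately have "(?f has_integral - (symbol_antideriv j 0 - symbol_antideriv j (- pi))
      + (symbol_antideriv j pi - symbol_antideriv j 0)) {-pi..pi}"
    by (intro has_integral_combine[of "-pi" 0 pi]) auto
  also have "- (symbol_antideriv j 0 - symbol_antideriv j (- pi))
      + (symbol_antideriv j pi - symbol_antideriv j 0)
      = - 2 * of_real (third_diff inverse (of_int j))"
    using symbol_antideriv_values[of j] by (simp add: algebra_simps)
  finally have "integral {-pi..pi} ?f = - 2 * of_real (third_diff inverse (of_int j))"
    by (rule integral_unique)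
  then show ?thesis
    unfolding tps_coeff_def by (simp add: power2_eq_square)
qed

section \<open>The partial fraction expansion of the cotangent\<close>

text \<open>
The logarithmic derivative of the reflection formula of the Gamma function; the reciprocal Gamma
function is used because it is entire.
\<close>

lemma Digamma_reflection:
  assumes "z \<notin> \<int>"
  shows "Digamma (1 - z) - Digamma z = of_real pi * cot (of_real pi * z :: complex)"
proof -
  have "z \<notin> \<int>\<^sub>\<le>\<^sub>0" "1 - z \<notin> \<int>\<^sub>\<le>\<^sub>0"
    using assms nonpos_Ints_subset_Ints Ints_1 Ints_diff[of 1 "1 - z"] by auto
  then have "((\<lambda>z. rGamma z * rGamma (1 - z)) has_field_derivative
      rGamma z * rGamma (1 - z) * (Digamma (1 - z) - Digamma z)) (at z)"
    by (auto intro!: derivative_eq_intros simp: algebra_simps)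
  moreover have "((\<lambda>z. rGamma z * rGamma (1 - z)) has_field_derivative cos (of_real pi * z)) (at z)"
    unfolding rGamma_reflection_complex by (auto intro!: derivative_eq_intros)
  ultimately have "sin (of_real pi * z) / of_real pi * (Digamma (1 - z) - Digamma z) = cos (of_real pi * z)"
    using DERIV_unique rGamma_reflection_complex by metis
  moreover have "sin (of_real pi * z) \<noteq> 0"
    using assms by (auto simp: sin_eq_0 mult.commute[of z])
  ultimately show ?thesis
    by (simp add: cot_def field_simps)
qed

text \<open>
The terms with \<open>k \<le> 0\<close> are those of the series of \<open>Digamma z\<close>, the others those of
\<open>Digamma (1 - z)\<close>. Each half diverges like a logarithm, and the logarithms cancel.
\<close>

lemma cot_window_limit:
  fixes z :: complex
  assumes "z \<notin> \<int>"
  shows "(\<lambda>N. \<Sum>k=-int N..int N. 1 / (z - of_int k)) \<longlonglongrightarrow> of_real pi * cot (of_real pi * z)"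
proof -
  define D where "D w m = of_real (ln (real m)) - (\<Sum>n<m. inverse (w + of_nat n))" for w :: complex and m
  have "z \<noteq> 0" "1 - z \<noteq> 0" using assms by auto
  then have lim: "D (1 - z) \<longlonglongrightarrow> Digamma (1 - z)" "D z \<longlonglongrightarrow> Digamma z"
    unfolding D_def by (intro Digamma_LIMSEQ; simp)+
  have "(\<Sum>k=-int N..int N. 1 / (z - of_int k))
      = (\<Sum>n<Suc N. inverse (z + of_nat n)) - (\<Sum>n<N. inverse (1 - z + of_nat n))" for N
  proof (induction N)
    case (Suc N)
    have "z - of_int (int (Suc N)) = - (1 - z + of_nat N)" by simp
    then have "1 / (z - of_int (int (Suc N))) = - inverse (1 - z + of_nat N)"
      by (simp only: inverse_eq_divide) (simp only: divide_minus_right)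
    then show ?case unfolding window_sum_Suc Suc by (simp add: inverse_eq_divide)
  qed (simp add: inverse_eq_divide)
  then have eq: "(\<Sum>k=-int N..int N. 1 / (z - of_int k))
      = D (1 - z) N - D z (Suc N) + of_real (ln (real (Suc N)) - ln (real N))" for N
    by (simp add: D_def)
  have "(\<lambda>N. ln (real (Suc N)) - ln (real N)) \<longlonglongrightarrow> 0"
    by real_asymp
  then have "(\<lambda>N. D (1 - z) N - D z (Suc N) + of_real (ln (real (Suc N)) - ln (real N)))
      \<longlonglongrightarrow> Digamma (1 - z) - Digamma z + of_real 0"
    by (intro tendsto_intros lim LIMSEQ_Suc)
  then show ?thesis
    unfolding eq Digamma_reflection[OF assms] by simp
qed

text \<open>
From \<open>cos w + i sin w = exp (i w)\<close> one gets \<open>cot w + i = exp (i w) / sin w\<close>, where the numerator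
decays and the denominator grows with the imaginary part of \<open>w\<close>.
\<close>

lemma norm_cot_plus_ii_le:
  assumes "Im z > 0"
  shows "norm (cot (of_real pi * z) + \<i>) \<le> 2 / (exp (2 * pi * Im z) - 1)"
proof -
  define w where "w = of_real pi * z"
  define s where "s = pi * Im z"
  have s: "s > 0" "Im w = s" using assms by (simp_all add: s_def w_def)
  have n1: "norm (exp (\<i> * w)) = exp (- s)" "norm (exp (- (\<i> * w))) = exp s"
    using s by simp_all
  have lower: "norm (exp (\<i> * w) - exp (- (\<i> * w))) \<ge> exp s - exp (- s)"
    using norm_triangle_ineq3[of "exp (\<i> * w)" "exp (- (\<i> * w))"] n1 by linarith
  have pos: "exp s - exp (- s) > 0" using s by simp
  have sin: "sin w = (exp (\<i> * w) - exp (- (\<i> * w))) / (2 * \<i>)"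
    by (simp add: sin_exp_eq)
  then have "sin w \<noteq> 0" using lower pos by auto
  then have "cot w + \<i> = exp (\<i> * w) / sin w"
    by (simp add: cot_def exp_Euler field_simps)
  also have "norm \<dots> = 2 * exp (- s) / norm (exp (\<i> * w) - exp (- (\<i> * w)))"
    unfolding sin norm_divide n1 by (simp add: norm_mult)
  also have "\<dots> \<le> 2 * exp (- s) / (exp s - exp (- s))"
    using lower pos by (intro divide_left_mono mult_pos_pos) auto
  also have "\<dots> = 2 / (exp (2 * s) - 1)"
  proof -
    have "exp s * exp (-s) = 1" "exp (2 * s) = exp s * exp s"
      by (simp_all flip: exp_add)
    moreover have "exp s * exp s - 1 \<noteq> 0"
      using s \<open>exp (2 * s) = _\<close> by (metis eq_iff_diff_eq_0 exp_eq_one_iff less_irrefl mult_eq_0_iff zero_neq_numeral)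
    ultimately show ?thesis using pos by (simp add: field_simps)
  qed
  finally show ?thesis by (simp add: w_def s_def mult_ac)
qed

lemma cot_minus_int_period: "cot (of_real pi * (z - of_int k)) = cot (of_real pi * z :: complex)"
proof -
  have e: "of_real pi * (z - of_int k) = of_real pi * z - of_real (pi * real_of_int k)"
    by (simp add: right_diff_distrib)
  have s: "sin (of_real (pi * real_of_int k) :: complex) = 0"
    by (simp only: sin_of_real sin_npi_int of_real_0)
  have "cos (of_real (pi * real_of_int k) :: complex) \<noteq> 0"
  proof
    assume "cos (of_real (pi * real_of_int k) :: complex) = 0"
    then have "0\<^sup>2 + 0\<^sup>2 = (1::complex)"
      using sin_cos_squared_add[of "of_real (pi * real_of_int k) :: complex"] by (simp only: s)
    then show False by simp
  qed
  then show ?thesis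
    unfolding e cot_def cos_diff sin_diff s by simp
qed

section \<open>Integrals over the half-line\<close>

abbreviation half_line :: "real measure" where
  "half_line \<equiv> restrict_space lborel {0<..}"

text \<open>
For an integrand of one sign, integrability over the half-line comes for free from the limits of
the antiderivative.
\<close>

lemma half_line_FTC_nonneg:
  fixes f F :: "real \<Rightarrow> real"
  assumes deriv: "\<And>s. s > 0 \<Longrightarrow> (F has_real_derivative f s) (at s)"
    and cont: "\<And>s. s > 0 \<Longrightarrow> isCont f s"
    and nonneg: "\<And>s. s > 0 \<Longrightarrow> f s \<ge> 0"
    and A: "(F \<longlongrightarrow> A) (at_right 0)" and B: "(F \<longlongrightarrow> B) at_top"
  shows "has_bochner_integral half_line f (B - A)"
proof -
  have e: "einterval 0 \<infinity> = {0::real<..}" by (auto simp: einterval_def zero_ereal_def)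
  note FTC = interval_integral_FTC_nonneg[of 0 \<infinity> F f A B]
  have pre: "(0::ereal) < \<infinity>" "\<And>s. 0 < ereal s \<Longrightarrow> ereal s < \<infinity> \<Longrightarrow> DERIV F s :> f s"
    "\<And>s. 0 < ereal s \<Longrightarrow> ereal s < \<infinity> \<Longrightarrow> isCont f s"
    "AE x in lborel. 0 < ereal x \<longrightarrow> ereal x < \<infinity> \<longrightarrow> 0 \<le> f x"
    "((F \<circ> real_of_ereal) \<longlongrightarrow> A) (at_right 0)" "((F \<circ> real_of_ereal) \<longlongrightarrow> B) (at_left \<infinity>)"
    using assms by (auto simp: ereal_tendsto_simps zero_ereal_def)
  have int: "set_integrable lborel {0<..} f" using FTC(1)[OF pre] by (simp add: e)
  have "(LBINT x=0..\<infinity>. f x) = B - A" by (rule FTC(2)[OF pre])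
  then have "set_lebesgue_integral lborel {0<..} f = B - A"
    by (simp add: interval_lebesgue_integral_def e)
  with int show ?thesis
    by (simp add: has_bochner_integral_iff integrable_restrict_space integral_restrict_space
        set_integrable_def set_lebesgue_integral_def)
qed

text \<open>
The integrand in \<open>y\<^sup>2 ln \<bar>y\<bar> = y\<^sup>2 \<integral> (s / (1 + s\<^sup>2) - s / (y\<^sup>2 + s\<^sup>2)) ds\<close>. The first term makes the
integral converge at infinity; it is quadratic in \<open>y\<close> and disappears on summation against the
coefficients.
\<close>

definition tps_kernel :: "real \<Rightarrow> real \<Rightarrow> real" where
  "tps_kernel y s = y\<^sup>2 * s / (1 + s\<^sup>2) - y\<^sup>2 * s / (y\<^sup>2 + s\<^sup>2)"

lemma tps_kernel_eq:
  assumes "s > 0"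
  shows "tps_kernel y s = y\<^sup>2 * (s / (1 + s\<^sup>2)) - s + s^3 / (y\<^sup>2 + s\<^sup>2)"
proof -
  have "y\<^sup>2 + s\<^sup>2 > 0" using assms by (simp add: add_nonneg_pos)
  moreover have "y\<^sup>2 * s + s^3 = s * (y\<^sup>2 + s\<^sup>2)"
    by (simp add: algebra_simps power2_eq_square power3_eq_cube)
  ultimately have "y\<^sup>2 * s / (y\<^sup>2 + s\<^sup>2) + s^3 / (y\<^sup>2 + s\<^sup>2) = s"
    by (simp flip: add_divide_distrib)
  then show ?thesis
    unfolding tps_kernel_def by simp
qed

lemma abs_tps_kernel_le:
  assumes "s > 0"
  shows "\<bar>tps_kernel y s\<bar> \<le> s * (y\<^sup>2 + 1)"
proof -
  have "y\<^sup>2 + s\<^sup>2 > 0" using assms by (simp add: add_nonneg_pos)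
  then have "0 \<le> y\<^sup>2 * s / (y\<^sup>2 + s\<^sup>2)" "y\<^sup>2 * s / (y\<^sup>2 + s\<^sup>2) \<le> s"
    using assms by (auto simp: field_simps)
  moreover have "0 \<le> y\<^sup>2 * s / (1 + s\<^sup>2)" "y\<^sup>2 * s / (1 + s\<^sup>2) \<le> s * y\<^sup>2"
    using assms by (auto simp: field_simps add_pos_nonneg)
  moreover have "s * (y\<^sup>2 + 1) = s * y\<^sup>2 + s" by (simp add: distrib_left)
  ultimately show ?thesis using assms unfolding tps_kernel_def by (intro abs_leI) linarith+
qed

text \<open>
The kernel has the sign of \<open>y\<^sup>2 - 1\<close> for all \<open>s\<close>, so the integral of its absolute value is as small
as it can be, namely the absolute value of its integral. This is what permits interchanging the
lattice sum with the integral.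
\<close>

lemma tps_kernel_integral:
  shows "has_bochner_integral half_line (tps_kernel y) (thin_plate \<bar>y\<bar>)"
    and "has_bochner_integral half_line (\<lambda>s. \<bar>tps_kernel y s\<bar>) \<bar>thin_plate \<bar>y\<bar>\<bar>"
proof -
  have "has_bochner_integral half_line (tps_kernel y) (thin_plate \<bar>y\<bar>) \<and>
     has_bochner_integral half_line (\<lambda>s. \<bar>tps_kernel y s\<bar>) \<bar>thin_plate \<bar>y\<bar>\<bar>"
  proof (cases "y = 0")
    case True
    then show ?thesis by (simp add: tps_kernel_def [abs_def] thin_plate_def has_bochner_integral_zero)
  next
    case False
    define c where "c = y\<^sup>2"
    have c: "c > 0" using False by (simp add: c_def)
    (* Antiderivative of the kernel in s; it tends to 0 at infinity and to minus the
    thin-plate spline at 0. *)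
    define F where "F s = c / 2 * (ln (1 + s\<^sup>2) - ln (c + s\<^sup>2))" for s
    have pos: "1 + s\<^sup>2 > 0" "c + s\<^sup>2 > 0" for s :: real
      using c by (simp_all add: add_pos_nonneg)
    have k: "tps_kernel y = (\<lambda>s. c * s / (1 + s\<^sup>2) - c * s / (c + s\<^sup>2))"
      by (simp add: tps_kernel_def [abs_def] c_def)
    have deriv: "(F has_real_derivative tps_kernel y s) (at s)" for s
      unfolding F_def [abs_def] k using pos[of s]
      by (auto intro!: derivative_eq_intros simp: divide_simps) (simp add: algebra_simps)
    have cont: "isCont (tps_kernel y) s" for s
      unfolding k using pos[of s] by (auto intro!: continuous_intros)
    have "isCont F 0"
      using deriv by (rule DERIV_isCont)
    then have "(F \<longlongrightarrow> F 0) (at_right 0)"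
      using continuous_at_imp_continuous_at_within continuous_within by blast
    moreover have "F 0 = - thin_plate \<bar>y\<bar>"
    proof -
      have "ln (y\<^sup>2) = 2 * ln \<bar>y\<bar>"
        using ln_realpow[of "\<bar>y\<bar>" 2] False by simp
      then show ?thesis using False by (simp add: F_def thin_plate_def c_def)
    qed
    ultimately have l0: "(F \<longlongrightarrow> - thin_plate \<bar>y\<bar>) (at_right 0)" by simp
    have linf: "(F \<longlongrightarrow> 0) at_top"
      unfolding F_def [abs_def] by real_asymp
    have sgn: "tps_kernel y s = (c - 1) * (c * s / ((1 + s\<^sup>2) * (c + s\<^sup>2)))" for s
      unfolding k using pos[of s] by (simp add: divide_simps) (simp add: algebra_simps)
    have nn: "c * s / ((1 + s\<^sup>2) * (c + s\<^sup>2)) \<ge> 0" if "s > 0" for s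
      using that pos[of s] c by (intro divide_nonneg_pos) auto
    show ?thesis
    proof (cases "c \<ge> 1")
      case True
      then have nonneg: "tps_kernel y s \<ge> 0" if "s > 0" for s
        unfolding sgn using nn[OF that] that by (intro mult_nonneg_nonneg) auto
      have *: "has_bochner_integral half_line (tps_kernel y) (0 - - thin_plate \<bar>y\<bar>)"
        by (rule half_line_FTC_nonneg[OF deriv cont nonneg l0 linf])
      moreover have "has_bochner_integral half_line (\<lambda>s. \<bar>tps_kernel y s\<bar>) (0 - - thin_plate \<bar>y\<bar>)"
        using * by (rule has_bochner_integral_cong[THEN iffD1, rotated -1])
          (auto simp: nonneg space_restrict_space)
      moreover have "thin_plate \<bar>y\<bar> \<ge> 0"
        using Bochner_Integration.integral_nonneg[of half_line "tps_kernel y"] nonneg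
          has_bochner_integral_integral_eq[OF *] by (simp add: space_restrict_space)
      ultimately show ?thesis by simp
    next
      case False
      then have nonneg: "- tps_kernel y s \<ge> 0" if "s > 0" for s
        unfolding sgn neg_0_le_iff_le using nn[OF that] by (intro mult_nonpos_nonneg) auto
      have *: "has_bochner_integral half_line (\<lambda>s. - tps_kernel y s) (- 0 - - (- thin_plate \<bar>y\<bar>))"
        by (rule half_line_FTC_nonneg[OF DERIV_minus[OF deriv] isCont_minus[OF cont] nonneg tendsto_minus[OF l0] tendsto_minus[OF linf]])
      moreover have "has_bochner_integral half_line (\<lambda>s. \<bar>tps_kernel y s\<bar>) (- 0 - - (- thin_plate \<bar>y\<bar>))"
        using * by (rule has_bochner_integral_cong[THEN iffD1, rotated -1])
          (use nonneg in \<open>fastforce simp: space_restrict_space\<close>)+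
      moreover have "thin_plate \<bar>y\<bar> \<le> 0"
        using Bochner_Integration.integral_nonneg[of half_line "\<lambda>s. - tps_kernel y s"] nonneg
          has_bochner_integral_integral_eq[OF *] by (simp add: space_restrict_space)
      moreover have "has_bochner_integral half_line (tps_kernel y) (thin_plate \<bar>y\<bar>)"
        using has_bochner_integral_minus[OF *] by simp
      ultimately show ?thesis by simp
    qed
  qed
  then show "has_bochner_integral half_line (tps_kernel y) (thin_plate \<bar>y\<bar>)"
    and "has_bochner_integral half_line (\<lambda>s. \<bar>tps_kernel y s\<bar>) \<bar>thin_plate \<bar>y\<bar>\<bar>" by auto
qed

lemma has_integral_cube_over_square_sum:
  "has_bochner_integral half_line (\<lambda>s. y^3 / (y\<^sup>2 + s\<^sup>2)) (pi / 2 * (y * \<bar>y\<bar>))"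
proof -
  have pos: "has_bochner_integral half_line (\<lambda>s. y^3 / (y\<^sup>2 + s\<^sup>2)) (pi / 2 * (y * \<bar>y\<bar>))" if y: "y > 0" for y :: real
  proof -
    have "y\<^sup>2 + s\<^sup>2 > 0" for s using y by (simp add: add_pos_nonneg)
    then have ne: "y\<^sup>2 + s\<^sup>2 \<noteq> 0" for s by (metis less_irrefl)
    have "((\<lambda>s. y\<^sup>2 * arctan (s / y)) has_real_derivative y^3 / (y\<^sup>2 + s\<^sup>2)) (at s)" for s
      using y ne[of s]
      by (auto intro!: derivative_eq_intros simp: power_divide field_simps power2_eq_square power3_eq_cube)
    moreover have "isCont (\<lambda>s. y^3 / (y\<^sup>2 + s\<^sup>2)) s" for s
      using ne by (auto intro!: continuous_intros)
    moreover have "((\<lambda>s. y\<^sup>2 * arctan (s / y)) \<longlongrightarrow> y\<^sup>2 * arctan (0 / y)) (at_right 0)"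
      by (intro tendsto_intros) (use y in auto)
    moreover have "((\<lambda>s. y\<^sup>2 * arctan (s / y)) \<longlongrightarrow> y\<^sup>2 * (pi / 2)) at_top"
      using y by real_asymp
    ultimately have "has_bochner_integral half_line (\<lambda>s. y^3 / (y\<^sup>2 + s\<^sup>2)) (y\<^sup>2 * (pi / 2) - y\<^sup>2 * arctan (0 / y))"
      using y by (intro half_line_FTC_nonneg) auto
    then show ?thesis using y by (simp add: power2_eq_square mult_ac)
  qed
  consider "y > 0" | "y = 0" | "y < 0" by linarith
  then show ?thesis
  proof cases
    case 3
    then show ?thesis using has_bochner_integral_minus[OF pos[of "- y"]] by simp
  next
    case 1
    then show ?thesis by (rule pos)
  next
    case 2
    then show ?thesis by (simp add: has_bochner_integral_zero)
  qed
qed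

text \<open>
Termwise integration of a lattice sum taken over symmetric windows, reduced to series over the natural numbers by
combining the terms at \<open>n\<close> and \<open>-n\<close>.
\<close>

lemma integral_window_limit:
  fixes f :: "int \<Rightarrow> 'a \<Rightarrow> real"
  assumes int: "\<And>j. integrable M (f j)"
    and norms: "summable (\<lambda>n. \<integral>s. \<bar>f (int n) s\<bar> \<partial>M)" "summable (\<lambda>n. \<integral>s. \<bar>f (- int n) s\<bar> \<partial>M)"
    and pt: "\<And>s. s \<in> space M \<Longrightarrow> summable (\<lambda>n. \<bar>f (int n) s\<bar>)"
      "\<And>s. s \<in> space M \<Longrightarrow> summable (\<lambda>n. \<bar>f (- int n) s\<bar>)"
    and lim: "\<And>s. s \<in> space M \<Longrightarrow> (\<lambda>N. \<Sum>j=-int N..int N. f j s) \<longlonglongrightarrow> g s"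
  shows "integrable M g" "(\<lambda>N. \<Sum>j=-int N..int N. integral\<^sup>L M (f j)) \<longlonglongrightarrow> integral\<^sup>L M g"
proof -
  define F where "F n s = (if n = 0 then f 0 s else f (int n) s + f (- int n) s)" for n s
  have window: "(\<Sum>n<Suc N. F n s) = (\<Sum>j=-int N..int N. f j s)" for N s
    by (induction N) (simp_all only: window_sum_Suc sum.lessThan_Suc, simp_all add: F_def)
  have F_int: "integrable M (F n)" for n
    unfolding F_def using int by (cases "n = 0") auto
  have F_le: "\<bar>F n s\<bar> \<le> \<bar>f (int n) s\<bar> + \<bar>f (- int n) s\<bar>" for n s
    unfolding F_def by (auto simp: abs_triangle_ineq)
  have "summable (\<lambda>n. norm (F n s))" if "s \<in> space M" for s
    by (rule summable_comparison_test'[OF summable_add[OF pt[OF that]]]) (simp add: F_le)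
  then have 1: "AE s in M. summable (\<lambda>n. norm (F n s))" by simp
  have 2: "summable (\<lambda>n. \<integral>s. norm (F n s) \<partial>M)"
  proof (rule summable_comparison_test'[OF summable_add[OF norms]])
    fix n
    have "(\<integral>s. norm (F n s) \<partial>M) \<le> (\<integral>s. \<bar>f (int n) s\<bar> + \<bar>f (- int n) s\<bar> \<partial>M)"
      using F_int int F_le by (intro integral_mono) auto
    also have "\<dots> = (\<integral>s. \<bar>f (int n) s\<bar> \<partial>M) + (\<integral>s. \<bar>f (- int n) s\<bar> \<partial>M)"
      using int by simp
    finally show "norm (\<integral>s. norm (F n s) \<partial>M) \<le> \<dots>" by simp
  qed
  have "(\<Sum>n. F n s) = g s" if "s \<in> space M" for s
  proof (rule sums_unique[symmetric])
    have "(\<lambda>N. \<Sum>n<Suc N. F n s) \<longlonglongrightarrow> g s" using lim[OF that] by (simp only: window)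
    then show "(\<lambda>n. F n s) sums g s" unfolding sums_def by (rule LIMSEQ_imp_Suc)
  qed
  then have g: "integral\<^sup>L M (\<lambda>s. \<Sum>n. F n s) = integral\<^sup>L M g"
      "integrable M (\<lambda>s. \<Sum>n. F n s) = integrable M g"
    by (auto intro!: Bochner_Integration.integral_cong Bochner_Integration.integrable_cong)
  show "integrable M g" using integrable_suminf[OF F_int 1 2] g by simp
  have "(\<lambda>n. integral\<^sup>L M (F n)) sums integral\<^sup>L M g"
    using sums_integral[OF F_int 1 2] g by simp
  then have "(\<lambda>N. \<Sum>n<Suc N. integral\<^sup>L M (F n)) \<longlonglongrightarrow> integral\<^sup>L M g"
    unfolding sums_def by (rule LIMSEQ_Suc)
  moreover have "(\<Sum>n<Suc N. integral\<^sup>L M (F n)) = (\<Sum>j=-int N..int N. integral\<^sup>L M (f j))" for N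
  proof -
    have "(\<Sum>n<Suc N. integral\<^sup>L M (F n)) = (\<integral>s. (\<Sum>n<Suc N. F n s) \<partial>M)"
      using F_int by (intro Bochner_Integration.integral_sum[symmetric]) auto
    also have "\<dots> = (\<Sum>j=-int N..int N. integral\<^sup>L M (f j))"
      unfolding window using int by (intro Bochner_Integration.integral_sum) auto
    finally show ?thesis .
  qed
  ultimately show "(\<lambda>N. \<Sum>j=-int N..int N. integral\<^sup>L M (f j)) \<longlonglongrightarrow> integral\<^sup>L M g" by simp
qed

section \<open>An integral representation of the quasi-Lagrange function\<close>

text \<open>
The limit is \<open>\<pi> cot (\<pi> p)\<close>, and half-odd numbers are the zeros of this function.
\<close>

lemma half_odd_window_limit:
  fixes p :: real
  assumes "cos (pi * p) = 0" "\<And>j. of_int j + complex_of_real p \<noteq> 0"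
  shows "(\<lambda>N. \<Sum>j=-int N..int N. inverse (of_int j + complex_of_real p)) \<longlonglongrightarrow> 0"
proof -
  have "- complex_of_real p \<notin> \<int>"
  proof
    assume "- complex_of_real p \<in> \<int>"
    then obtain m where m: "- complex_of_real p = of_int m" by (elim Ints_cases)
    have "of_int m + complex_of_real p = 0" unfolding m[symmetric] by simp
    then show False using assms(2) by blast
  qed
  from tendsto_minus[OF cot_window_limit[OF this]]
  have "(\<lambda>N. - (\<Sum>j=-int N..int N. 1 / (- complex_of_real p - of_int j)))
      \<longlonglongrightarrow> - (of_real pi * cot (of_real pi * - complex_of_real p))" .
  moreover have "cos (of_real pi * - complex_of_real p) = of_real (cos (pi * p))"
    by (simp only: mult_minus_right cos_minus cos_of_real flip: of_real_mult)
  then have "cot (of_real pi * - complex_of_real p) = 0"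
    using assms(1) by (simp add: cot_def)
  moreover have "- (1 / (- complex_of_real p - of_int j)) = inverse (of_int j + complex_of_real p)" for j
  proof -
    have "- complex_of_real p - of_int j = - (of_int j + complex_of_real p)" by simp
    then show ?thesis by (simp only: inverse_eq_divide divide_minus_right minus_minus)
  qed
  ultimately show ?thesis by (simp add: sum_negf[symmetric])
qed

text \<open>
Decompose each summand into partial fractions in \<open>j\<close>. The polynomial part is linear in the shift and
is killed by the third difference. The poles \<open>j = - p\<close> lie at half-odd numbers and contribute 0 in
the limit. Only the pole at \<open>j = z\<close> is left, and it produces the cotangent. In particular the
coefficients have vanishing moments up to order 2, which is the case \<open>\<gamma> = 0\<close>.
\<close>

lemma third_diff_inverse_window_limit:
  fixes z :: complex
  assumes z: "z \<notin> \<int>" "z + 3/2 \<noteq> 0" "z + 1/2 \<noteq> 0" "z - 1/2 \<noteq> 0" "z - 3/2 \<noteq> 0"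
  shows "(\<lambda>N. \<Sum>j=-int N..int N. third_diff inverse (of_int j)
             * (\<alpha> * (x - of_int j)\<^sup>2 + \<beta> + \<gamma> / (z - of_int j)))
         \<longlonglongrightarrow> \<gamma> * third_diff inverse z * (of_real pi * cot (of_real pi * z))"
proof -
  (* K p is the residue at j = - p of the rational function in the p-th term. *)
  define K where "K p = \<alpha> * (x + p)\<^sup>2 + \<beta> + \<gamma> / (z + p)" for p
  have split: "inverse (of_int j + p) * (\<alpha> * (x - of_int j)\<^sup>2 + \<beta> + \<gamma> / (z - of_int j))
      = \<alpha> * (of_int j - p - 2 * x) + K p * inverse (of_int j + p) + \<gamma> * inverse (z + p) * (1 / (z - of_int j))"
    if "of_int j + p \<noteq> 0" "z + p \<noteq> 0" for j p
  proof -
    have "z - of_int j \<noteq> 0" using z(1) by auto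
    define a b c where "a = of_int j + p" and "b = z + p" and "c = x + p"
    have e: "x - of_int j = c - a" "z - of_int j = b - a" "of_int j - p - 2 * x = a - 2 * c"
      "of_int j + p = a" "x + p = c" "z + p = b"
      by (simp_all add: a_def b_def c_def)
    have "inverse a * (\<alpha> * (c - a)\<^sup>2 + \<beta> + \<gamma> / (b - a))
      = \<alpha> * (a - 2 * c) + (\<alpha> * c\<^sup>2 + \<beta> + \<gamma> / b) * inverse a + \<gamma> * inverse b * (1 / (b - a))"
    proof -
      have nz: "a \<noteq> 0" "b \<noteq> 0" "b - a \<noteq> 0"
        using that \<open>z - of_int j \<noteq> 0\<close> by (simp_all add: a_def b_def)
      have "inverse a * (\<gamma> / (b - a)) = \<gamma> / b * inverse a + \<gamma> * inverse b * (1 / (b - a))"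
        using nz by (simp add: divide_simps) (simp add: algebra_simps)
      moreover have "inverse a * (\<alpha> * (c - a)\<^sup>2) = \<alpha> * (a - 2 * c) + \<alpha> * c\<^sup>2 * inverse a"
        using nz by (simp add: divide_simps) (simp add: algebra_simps power2_eq_square)
      ultimately show ?thesis by (simp add: algebra_simps)
    qed
    then show ?thesis unfolding K_def e .
  qed
  have split_minus: "inverse (of_int j - p) * (\<alpha> * (x - of_int j)\<^sup>2 + \<beta> + \<gamma> / (z - of_int j))
      = \<alpha> * (of_int j + p - 2 * x) + K (- p) * inverse (of_int j - p) + \<gamma> * inverse (z - p) * (1 / (z - of_int j))"
    if "of_int j - p \<noteq> 0" "z - p \<noteq> 0" for j p
    using split[of j "- p"] that by simp
  have summand: "third_diff inverse (of_int j) * (\<alpha> * (x - of_int j)\<^sup>2 + \<beta> + \<gamma> / (z - of_int j))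
      = K (3/2) * inverse (of_int j + 3/2) - 3 * (K (1/2) * inverse (of_int j + 1/2))
        + 3 * (K (- (1/2)) * inverse (of_int j - 1/2)) - K (- (3/2)) * inverse (of_int j - 3/2)
        + \<gamma> * third_diff inverse z * (1 / (z - of_int j))" for j
  proof -
    define Q where "Q = \<alpha> * (x - of_int j)\<^sup>2 + \<beta> + \<gamma> / (z - of_int j)"
    define w where "w = 1 / (z - of_int j)"
    note nz = z int_plus_half_odd_nonzero[of j, where ?'a = complex]
    have "inverse (of_int j + 3/2) * Q
        = \<alpha> * (of_int j - 3/2 - 2 * x) + K (3/2) * inverse (of_int j + 3/2) + \<gamma> * inverse (z + 3/2) * w"
      using split[of j "3/2"] nz unfolding Q_def w_def by blast
    moreover have "inverse (of_int j + 1/2) * Q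
        = \<alpha> * (of_int j - 1/2 - 2 * x) + K (1/2) * inverse (of_int j + 1/2) + \<gamma> * inverse (z + 1/2) * w"
      using split[of j "1/2"] nz unfolding Q_def w_def by blast
    moreover have "inverse (of_int j - 1/2) * Q
        = \<alpha> * (of_int j + 1/2 - 2 * x) + K (- (1/2)) * inverse (of_int j - 1/2) + \<gamma> * inverse (z - 1/2) * w"
      using split_minus[of j "1/2"] nz unfolding Q_def w_def by blast
    moreover have "inverse (of_int j - 3/2) * Q
        = \<alpha> * (of_int j + 3/2 - 2 * x) + K (- (3/2)) * inverse (of_int j - 3/2) + \<gamma> * inverse (z - 3/2) * w"
      using split_minus[of j "3/2"] nz unfolding Q_def w_def by blast
    moreover have "(i1 - 3 * i2 + 3 * i3 - i4) * Q
        = k1 * i1 - 3 * (k2 * i2) + 3 * (k3 * i3) - k4 * i4 + \<gamma> * (z1 - 3 * z2 + 3 * z3 - z4) * w"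
      if "i1 * Q = \<alpha> * (J - 3/2 - X) + k1 * i1 + \<gamma> * z1 * w" "i2 * Q = \<alpha> * (J - 1/2 - X) + k2 * i2 + \<gamma> * z2 * w"
         "i3 * Q = \<alpha> * (J + 1/2 - X) + k3 * i3 + \<gamma> * z3 * w" "i4 * Q = \<alpha> * (J + 3/2 - X) + k4 * i4 + \<gamma> * z4 * w"
      for i1 i2 i3 i4 k1 k2 k3 k4 z1 z2 z3 z4 J X
    proof -
      have "(i1 - 3 * i2 + 3 * i3 - i4) * Q = i1 * Q - 3 * (i2 * Q) + 3 * (i3 * Q) - i4 * Q"
        by (simp add: algebra_simps)
      then show ?thesis unfolding that by (simp add: algebra_simps)
    qed
    ultimately show ?thesis
      unfolding third_diff_def Q_def[symmetric] w_def[symmetric] by blast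
  qed
  have half: "(\<lambda>N. \<Sum>j=-int N..int N. inverse (of_int j + complex_of_real p)) \<longlonglongrightarrow> 0"
    if "\<bar>p\<bar> = 3/2 \<or> \<bar>p\<bar> = 1/2" for p
  proof (rule half_odd_window_limit)
    have "cos (\<bar>p\<bar> * pi) = 0"
      using that
    proof
      assume p: "\<bar>p\<bar> = 3/2"
      show ?thesis unfolding p using cos_3over2_pi by simp
    next
      assume p: "\<bar>p\<bar> = 1/2"
      show ?thesis unfolding p by simp
    qed
    then show "cos (pi * p) = 0" by (simp add: abs_if mult.commute[of pi] split: if_splits)
    show "of_int j + complex_of_real p \<noteq> 0" for j
    proof
      assume "of_int j + complex_of_real p = 0"
      then have "complex_of_real (real_of_int j + p) = 0" by simp
      then have "real_of_int j + p = 0" by (simp only: of_real_eq_0_iff)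
      then have "real_of_int j + 3/2 = 0 \<or> real_of_int j + 1/2 = 0 \<or> real_of_int j - 1/2 = 0 \<or> real_of_int j - 3/2 = 0"
        using that by linarith
      then show False
        using int_plus_half_odd_nonzero[of j, where ?'a = real] by blast
    qed
  qed
  have h: "(\<lambda>N. \<Sum>j=-int N..int N. inverse (of_int j + 3/2 :: complex)) \<longlonglongrightarrow> 0"
    "(\<lambda>N. \<Sum>j=-int N..int N. inverse (of_int j + 1/2 :: complex)) \<longlonglongrightarrow> 0"
    "(\<lambda>N. \<Sum>j=-int N..int N. inverse (of_int j - 1/2 :: complex)) \<longlonglongrightarrow> 0"
    "(\<lambda>N. \<Sum>j=-int N..int N. inverse (of_int j - 3/2 :: complex)) \<longlonglongrightarrow> 0"
    using half[of "3/2"] half[of "1/2"] half[of "-1/2"] half[of "-3/2"] by simp_all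
  have "(\<lambda>N. K (3/2) * (\<Sum>j=-int N..int N. inverse (of_int j + 3/2))
        - 3 * (K (1/2) * (\<Sum>j=-int N..int N. inverse (of_int j + 1/2)))
        + 3 * (K (- (1/2)) * (\<Sum>j=-int N..int N. inverse (of_int j - 1/2)))
        - K (- (3/2)) * (\<Sum>j=-int N..int N. inverse (of_int j - 3/2))
        + \<gamma> * third_diff inverse z * (\<Sum>j=-int N..int N. 1 / (z - of_int j)))
     \<longlonglongrightarrow> K (3/2) * 0 - 3 * (K (1/2) * 0) + 3 * (K (- (1/2)) * 0) - K (- (3/2)) * 0
        + \<gamma> * third_diff inverse z * (of_real pi * cot (of_real pi * z))"
    by (intro tendsto_intros h cot_window_limit z(1))
  moreover have "(\<Sum>j=-int N..int N. third_diff inverse (of_int j)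
             * (\<alpha> * (x - of_int j)\<^sup>2 + \<beta> + \<gamma> / (z - of_int j)))
      = K (3/2) * (\<Sum>j=-int N..int N. inverse (of_int j + 3/2))
        - 3 * (K (1/2) * (\<Sum>j=-int N..int N. inverse (of_int j + 1/2)))
        + 3 * (K (- (1/2)) * (\<Sum>j=-int N..int N. inverse (of_int j - 1/2)))
        - K (- (3/2)) * (\<Sum>j=-int N..int N. inverse (of_int j - 3/2))
        + \<gamma> * third_diff inverse z * (\<Sum>j=-int N..int N. 1 / (z - of_int j))" for N
    unfolding summand sum.distrib sum_subtractf sum_distrib_left ..
  ultimately show ?thesis by simp
qed

lemma summable_third_diff_inverse_weighted:
  "summable (\<lambda>n. \<bar>third_diff inverse (real n) * ((x - real n)\<^sup>2 + 1)\<bar>)"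
  "summable (\<lambda>n. \<bar>third_diff inverse (- real n) * ((x + real n)\<^sup>2 + 1)\<bar>)"
proof -
  have *: "summable (\<lambda>n. norm (real n powr (-2)))"
    by (simp add: summable_real_powr_iff)
  show "summable (\<lambda>n. \<bar>third_diff inverse (real n) * ((x - real n)\<^sup>2 + 1)\<bar>)"
    by (rule summable_comparison_test_bigo[OF *]) (unfold third_diff_def, real_asymp)
  show "summable (\<lambda>n. \<bar>third_diff inverse (- real n) * ((x + real n)\<^sup>2 + 1)\<bar>)"
    by (rule summable_comparison_test_bigo[OF *]) (unfold third_diff_def, real_asymp)
qed

text \<open>
The coefficients are of order \<open>n\<^sup>-\<^sup>4\<close> and the thin-plate spline of order \<open>n\<^sup>2 ln n\<close>; the exponent
\<open>-3/2\<close> leaves room for the logarithm.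
\<close>

lemma summable_third_diff_inverse_thin_plate:
  "summable (\<lambda>n. \<bar>third_diff inverse (real n) * thin_plate \<bar>x - real n\<bar>\<bar>)"
  "summable (\<lambda>n. \<bar>third_diff inverse (- real n) * thin_plate \<bar>x + real n\<bar>\<bar>)"
proof -
  have *: "summable (\<lambda>n. norm (real n powr (-3/2)))"
    by (simp add: summable_real_powr_iff)
  have 1: "\<forall>\<^sub>F n in sequentially. thin_plate \<bar>x - real n\<bar> = (real n - x)\<^sup>2 * ln (real n - x)"
  proof -
    have "\<forall>\<^sub>F n in sequentially. real n > x" by real_asymp
    then show ?thesis by eventually_elim (simp add: thin_plate_def power2_commute)
  qed
  have 2: "\<forall>\<^sub>F n in sequentially. thin_plate \<bar>x + real n\<bar> = (real n + x)\<^sup>2 * ln (real n + x)"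
  proof -
    have "\<forall>\<^sub>F n in sequentially. real n > -x" by real_asymp
    then show ?thesis by eventually_elim (simp add: thin_plate_def add.commute)
  qed
  show "summable (\<lambda>n. \<bar>third_diff inverse (real n) * thin_plate \<bar>x - real n\<bar>\<bar>)"
  proof (rule summable_comparison_test_bigo[OF *])
    have "(\<lambda>n. \<bar>third_diff inverse (real n) * ((real n - x)\<^sup>2 * ln (real n - x))\<bar>) \<in> O(\<lambda>n. real n powr (-3/2))"
      unfolding third_diff_def by real_asymp
    then show "(\<lambda>n. \<bar>third_diff inverse (real n) * thin_plate \<bar>x - real n\<bar>\<bar>) \<in> O(\<lambda>n. real n powr (-3/2))"
      by (rule landau_o.big.in_cong[THEN iffD1, rotated]) (use 1 in eventually_elim, simp)
  qed
  show "summable (\<lambda>n. \<bar>third_diff inverse (- real n) * thin_plate \<bar>x + real n\<bar>\<bar>)"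
  proof (rule summable_comparison_test_bigo[OF *])
    have "(\<lambda>n. \<bar>third_diff inverse (- real n) * ((real n + x)\<^sup>2 * ln (real n + x))\<bar>) \<in> O(\<lambda>n. real n powr (-3/2))"
      unfolding third_diff_def by real_asymp
    then show "(\<lambda>n. \<bar>third_diff inverse (- real n) * thin_plate \<bar>x + real n\<bar>\<bar>) \<in> O(\<lambda>n. real n powr (-3/2))"
      by (rule landau_o.big.in_cong[THEN iffD1, rotated]) (use 2 in eventually_elim, simp)
  qed
qed

lemma upper_half_plane_nonzero:
  assumes "s > 0"
  shows "Complex x s \<notin> \<int>" "Complex x s + 3/2 \<noteq> 0" "Complex x s + 1/2 \<noteq> 0"
    "Complex x s - 1/2 \<noteq> 0" "Complex x s - 3/2 \<noteq> 0"
  using assms by (auto simp: complex_eq_iff elim!: Ints_cases)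

text \<open>
The kernel is the real part of \<open>\<alpha> (x - j)\<^sup>2 + \<beta> + \<gamma> / (z - j)\<close> for \<open>\<alpha> = s / (1 + s\<^sup>2)\<close>, \<open>\<beta> = - s\<close> and
\<open>\<gamma> = i s\<^sup>2\<close>, so the lattice sum can be evaluated in closed form.
\<close>

lemma kernel_window_limit:
  assumes s: "s > 0"
  shows "(\<lambda>N. \<Sum>j=-int N..int N. third_diff inverse (real_of_int j) * tps_kernel (x - real_of_int j) s)
     \<longlonglongrightarrow> - pi * (s\<^sup>2 * Im (cot (of_real pi * Complex x s) * third_diff inverse (Complex x s)))"
proof -
  let ?z = "Complex x s"
  let ?t = "\<lambda>j. third_diff inverse (of_int j) * (of_real (s / (1 + s\<^sup>2)) * (of_real x - of_int j)\<^sup>2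
     + of_real (- s) + of_real (s\<^sup>2) * \<i> / (?z - of_int j))"
  have "third_diff inverse (real_of_int j) * tps_kernel (x - real_of_int j) s = Re (?t j)" for j
  proof -
    have d: "third_diff inverse (of_int j) = complex_of_real (third_diff inverse (real_of_int j))"
      unfolding third_diff_def by simp
    have "Re (of_real (s\<^sup>2) * \<i> / (?z - of_int j)) = s^3 / ((x - real_of_int j)\<^sup>2 + s\<^sup>2)"
    proof -
      have "Re (of_real c * \<i> / w) = c * Im w / ((Re w)\<^sup>2 + (Im w)\<^sup>2)" for c w
        by (simp add: Re_divide)
      then show ?thesis by (simp only:) (simp add: power2_eq_square power3_eq_cube)
    qed
    moreover have "Re (of_real (s / (1 + s\<^sup>2)) * (of_real x - of_int j)\<^sup>2) = s / (1 + s\<^sup>2) * (x - real_of_int j)\<^sup>2"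
    proof -
      have eq: "of_real x - of_int j = complex_of_real (x - real_of_int j)" by simp
      show ?thesis unfolding eq by (simp only: Re_complex_of_real flip: of_real_power of_real_mult)
    qed
    ultimately show ?thesis
      unfolding d tps_kernel_eq[OF s] by simp
  qed
  moreover have "(\<lambda>N. Re (\<Sum>j=-int N..int N. ?t j)) \<longlonglongrightarrow>
      Re (of_real (s\<^sup>2) * \<i> * third_diff inverse ?z * (of_real pi * cot (of_real pi * ?z)))"
    by (intro tendsto_Re third_diff_inverse_window_limit upper_half_plane_nonzero s)
  moreover have "Re (of_real (s\<^sup>2) * \<i> * third_diff inverse ?z * (of_real pi * cot (of_real pi * ?z)))
      = - pi * (s\<^sup>2 * Im (cot (of_real pi * ?z) * third_diff inverse ?z))"
    by (simp add: algebra_simps)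
  ultimately show ?thesis by (simp add: Re_sum)
qed

definition lagrange_integral :: "real \<Rightarrow> real" where
  "lagrange_integral x = (\<integral>s. s\<^sup>2 * Im (cot (of_real pi * Complex x s) * third_diff inverse (Complex x s)) \<partial>half_line)
     / (2 * pi)"

lemma quasi_lagrange_eq_lagrange_integral:
  shows "integrable half_line (\<lambda>s. s\<^sup>2 * Im (cot (of_real pi * Complex x s) * third_diff inverse (Complex x s)))"
    and "quasi_lagrange x = of_real (lagrange_integral x)"
proof -
  let ?G = "\<lambda>s. s\<^sup>2 * Im (cot (of_real pi * Complex x s) * third_diff inverse (Complex x s))"
  define d where "d j = third_diff inverse (real_of_int j)" for j
  define f where "f j s = d j * tps_kernel (x - real_of_int j) s" for j s
  have f_int: "has_bochner_integral half_line (f j) (d j * thin_plate \<bar>x - real_of_int j\<bar>)" for j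
    unfolding f_def by (intro has_bochner_integral_mult_right tps_kernel_integral)
  have f_abs: "has_bochner_integral half_line (\<lambda>s. \<bar>f j s\<bar>) \<bar>d j * thin_plate \<bar>x - real_of_int j\<bar>\<bar>" for j
    unfolding f_def abs_mult by (intro has_bochner_integral_mult_right tps_kernel_integral)
  have f_le: "\<bar>f j s\<bar> \<le> s * \<bar>d j * ((x - real_of_int j)\<^sup>2 + 1)\<bar>" if "s > 0" for j s
  proof -
    have "\<bar>(x - real_of_int j)\<^sup>2 + 1\<bar> = (x - real_of_int j)\<^sup>2 + 1" by simp
    then show ?thesis
      using mult_left_mono[OF abs_tps_kernel_le[OF that, of "x - real_of_int j"], of "\<bar>d j\<bar>"]
      unfolding f_def abs_mult by (simp only: mult.left_commute abs_ge_zero simp_thms)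
  qed
  have pt: "summable (\<lambda>n. \<bar>f (int n) s\<bar>)" "summable (\<lambda>n. \<bar>f (- int n) s\<bar>)" if "s > 0" for s
  proof -
    show "summable (\<lambda>n. \<bar>f (int n) s\<bar>)"
      by (rule summable_comparison_test'[OF summable_mult[OF summable_third_diff_inverse_weighted(1)[of x], of s]])
        (use f_le[OF that, of "int _"] in \<open>simp add: d_def\<close>)
    show "summable (\<lambda>n. \<bar>f (- int n) s\<bar>)"
      by (rule summable_comparison_test'[OF summable_mult[OF summable_third_diff_inverse_weighted(2)[of x], of s]])
        (use f_le[OF that, of "- int _"] in \<open>simp add: d_def\<close>)
  qed
  have norms: "summable (\<lambda>n. \<bar>d (int n) * thin_plate \<bar>x - real_of_int (int n)\<bar>\<bar>)"
    "summable (\<lambda>n. \<bar>d (- int n) * thin_plate \<bar>x - real_of_int (- int n)\<bar>\<bar>)"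
    using summable_third_diff_inverse_thin_plate[of x] by (simp_all add: d_def)
  have lim: "(\<lambda>N. \<Sum>j=-int N..int N. f j s) \<longlonglongrightarrow> - pi * ?G s" if "s > 0" for s
    using kernel_window_limit[OF that, of x] unfolding f_def d_def .
  have G: "integrable half_line (\<lambda>s. - pi * ?G s)"
      "(\<lambda>N. \<Sum>j=-int N..int N. integral\<^sup>L half_line (f j)) \<longlonglongrightarrow> (\<integral>s. - pi * ?G s \<partial>half_line)"
    using integral_window_limit[of half_line f "\<lambda>s. - pi * ?G s"] f_int f_abs norms pt lim
    by (simp_all add: has_bochner_integral_iff space_restrict_space)
  have "integrable half_line (\<lambda>s. - (1 / pi) * (- pi * ?G s))"
    using G(1) by (rule integrable_mult_right)
  then show G_int: "integrable half_line ?G" by simp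
  have "(\<lambda>N. - 1 / (2 * pi\<^sup>2) * (\<Sum>j=-int N..int N. d j * thin_plate \<bar>x - real_of_int j\<bar>))
      \<longlonglongrightarrow> - 1 / (2 * pi\<^sup>2) * (- pi * integral\<^sup>L half_line ?G)"
    using G(2) unfolding has_bochner_integral_integral_eq[OF f_int] integral_mult_right_zero
    by (intro tendsto_intros)
  moreover have "- 1 / (2 * pi\<^sup>2) * (- pi * integral\<^sup>L half_line ?G) = lagrange_integral x"
    unfolding lagrange_integral_def by (simp add: power2_eq_square)
  ultimately have real_lim: "(\<lambda>N. \<Sum>j=-int N..int N. - 1 / (2 * pi\<^sup>2) * (d j * thin_plate \<bar>x - real_of_int j\<bar>))
      \<longlonglongrightarrow> lagrange_integral x"
    by (simp only: sum_distrib_left)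
  have summand: "tps_coeff j * of_real (thin_plate \<bar>x - of_int j\<bar>)
      = of_real (- 1 / (2 * pi\<^sup>2) * (d j * thin_plate \<bar>x - real_of_int j\<bar>))" for j
    unfolding tps_coeff_eq d_def by simp
  have "((\<lambda>j. - 1 / (2 * pi\<^sup>2) * (d j * thin_plate \<bar>x - real_of_int j\<bar>)) has_sum lagrange_integral x) UNIV"
    by (intro has_sum_int_window_limit summable_on_int_if_summable_tails real_lim)
      (use norms[THEN summable_mult, of "1 / (2 * pi\<^sup>2)"] in \<open>simp_all add: abs_mult\<close>)
  then have "((\<lambda>j. tps_coeff j * of_real (thin_plate \<bar>x - of_int j\<bar>)) has_sum of_real (lagrange_integral x)) UNIV"
    unfolding summand by (rule has_sum_of_real)
  then show "quasi_lagrange x = of_real (lagrange_integral x)"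
    unfolding quasi_lagrange_def by (rule infsumI)
qed

section \<open>Splitting off a quadratic B-spline\<close>

text \<open>
Since \<open>s\<^sup>2 Re (1 / (y + i s)) = y - y\<^sup>3 / (y\<^sup>2 + s\<^sup>2)\<close> and third differences annihilate \<open>y\<close>, only the
integral of \<open>y\<^sup>3 / (y\<^sup>2 + s\<^sup>2)\<close> matters, which is \<open>\<pi> y \<bar>y\<bar> / 2\<close>.
\<close>

lemma spline_part_integral:
  "has_bochner_integral half_line (\<lambda>s. s\<^sup>2 * Re (third_diff inverse (Complex x s)))
     (- (pi / 2) * third_diff (\<lambda>y. y * \<bar>y\<bar>) x)"
proof -
  let ?c = "\<lambda>s y. y^3 / (y\<^sup>2 + s\<^sup>2) :: real"
  have "has_bochner_integral half_line
      (\<lambda>s. - (?c s (x + 3/2) - 3 * ?c s (x + 1/2) + 3 * ?c s (x - 1/2) - ?c s (x - 3/2)))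
      (- (pi / 2 * ((x + 3/2) * \<bar>x + 3/2\<bar>) - 3 * (pi / 2 * ((x + 1/2) * \<bar>x + 1/2\<bar>))
        + 3 * (pi / 2 * ((x - 1/2) * \<bar>x - 1/2\<bar>)) - pi / 2 * ((x - 3/2) * \<bar>x - 3/2\<bar>)))"
    by (intro has_bochner_integral_minus has_bochner_integral_add has_bochner_integral_diff
        has_bochner_integral_mult_right has_integral_cube_over_square_sum)
  moreover have "- (pi / 2 * ((x + 3/2) * \<bar>x + 3/2\<bar>) - 3 * (pi / 2 * ((x + 1/2) * \<bar>x + 1/2\<bar>))
        + 3 * (pi / 2 * ((x - 1/2) * \<bar>x - 1/2\<bar>)) - pi / 2 * ((x - 3/2) * \<bar>x - 3/2\<bar>))
      = - (pi / 2) * third_diff (\<lambda>y. y * \<bar>y\<bar>) x"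
    unfolding third_diff_def by (simp add: right_diff_distrib distrib_left)
  moreover have "s\<^sup>2 * Re (third_diff inverse (Complex x s))
      = - (?c s (x + 3/2) - 3 * ?c s (x + 1/2) + 3 * ?c s (x - 1/2) - ?c s (x - 3/2))"
    if s: "s > 0" for s
  proof -
    have inv: "s\<^sup>2 * Re (inverse (Complex y s)) = y - ?c s y" for y
    proof -
      have "y\<^sup>2 + s\<^sup>2 \<noteq> 0" using s by (simp add: sum_power2_eq_zero_iff)
      moreover have "s\<^sup>2 * y + y^3 = y * (y\<^sup>2 + s\<^sup>2)"
        by (simp add: algebra_simps power2_eq_square power3_eq_cube)
      ultimately have "s\<^sup>2 * y / (y\<^sup>2 + s\<^sup>2) + ?c s y = y" by (simp flip: add_divide_distrib)
      then show ?thesis by simp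
    qed
    have shift: "Complex x s + 3/2 = Complex (x + 3/2) s" "Complex x s + 1/2 = Complex (x + 1/2) s"
      "Complex x s - 1/2 = Complex (x - 1/2) s" "Complex x s - 3/2 = Complex (x - 3/2) s"
      by (simp_all add: complex_eq_iff)
    have "s\<^sup>2 * Re (third_diff inverse (Complex x s))
      = s\<^sup>2 * Re (inverse (Complex (x + 3/2) s)) - 3 * (s\<^sup>2 * Re (inverse (Complex (x + 1/2) s)))
        + 3 * (s\<^sup>2 * Re (inverse (Complex (x - 1/2) s))) - s\<^sup>2 * Re (inverse (Complex (x - 3/2) s))"
      unfolding third_diff_def shift by (simp add: algebra_simps del: complex_inverse inverse_complex.simps)
    then show ?thesis unfolding inv by simp
  qed
  ultimately show ?thesis
    by (subst has_bochner_integral_cong[OF refl _ refl]) (auto simp: space_restrict_space)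
qed

definition cot_remainder :: "real \<Rightarrow> real" where
  "cot_remainder x = (\<integral>s. s\<^sup>2 * Im ((cot (of_real pi * Complex x s) + \<i>) * third_diff inverse (Complex x s)) \<partial>half_line)"

text \<open>
Replacing the cotangent by \<open>(cot + i) - i\<close> separates the B-spline from the remainder. The remainder
inherits its integrability from the other two integrals, which saves an estimate near the poles on
the real axis.
\<close>

lemma lagrange_integral_split:
  shows "integrable half_line (\<lambda>s. s\<^sup>2 * Im ((cot (of_real pi * Complex x s) + \<i>) * third_diff inverse (Complex x s)))"
    and "lagrange_integral x = third_diff (\<lambda>y. y * \<bar>y\<bar>) x / 4 + cot_remainder x / (2 * pi)"
proof -
  have eq: "s\<^sup>2 * Im ((cot (of_real pi * Complex x s) + \<i>) * third_diff inverse (Complex x s))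
      = s\<^sup>2 * Im (cot (of_real pi * Complex x s) * third_diff inverse (Complex x s))
        + s\<^sup>2 * Re (third_diff inverse (Complex x s))" for s
    by (simp add: distrib_right distrib_left)
  note ints = quasi_lagrange_eq_lagrange_integral(1)[of x] spline_part_integral[of x, unfolded has_bochner_integral_iff]
  show "integrable half_line (\<lambda>s. s\<^sup>2 * Im ((cot (of_real pi * Complex x s) + \<i>) * third_diff inverse (Complex x s)))"
    unfolding eq using ints by simp
  have "cot_remainder x = 2 * pi * lagrange_integral x - pi / 2 * third_diff (\<lambda>y. y * \<bar>y\<bar>) x"
    unfolding cot_remainder_def eq lagrange_integral_def using ints by simp
  then show "lagrange_integral x = third_diff (\<lambda>y. y * \<bar>y\<bar>) x / 4 + cot_remainder x / (2 * pi)"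
    by (simp add: field_simps)
qed

section \<open>Decay and moments of the remainder\<close>

text \<open>
Makes \<open>s\<^sup>2 / (exp (2 \<pi> s) - 1)\<close> comparable to \<open>1 / (1 + s\<^sup>2)\<close>, both for small and for large \<open>s\<close>.
\<close>

lemma exp_minus_one_lower:
  assumes "s > 0"
  shows "s\<^sup>2 * (1 + s\<^sup>2) \<le> exp (2 * pi * s) - (1::real)"
proof -
  have "3 * s \<le> pi * s" using assms pi_gt3 by simp
  have "1 + 3 * s + (3 * s)\<^sup>2 / 2 \<le> exp (3 * s)"
    using assms by (intro exp_lower_Taylor_quadratic) simp
  also have "\<dots> \<le> exp (pi * s)" using \<open>3 * s \<le> pi * s\<close> by simp
  finally have "(1 + (3 * s)\<^sup>2 / 2)\<^sup>2 \<le> (exp (pi * s))\<^sup>2"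
    using assms by (intro power_mono) auto
  moreover have "(exp (pi * s))\<^sup>2 = exp (2 * pi * s)"
    by (simp add: power2_eq_square mult_ac flip: exp_add)
  moreover have "(1 + (3 * s)\<^sup>2 / 2)\<^sup>2 = 1 + 9 * s\<^sup>2 + 81 / 4 * (s\<^sup>2 * s\<^sup>2)"
    by (simp add: power2_eq_square field_simps)
  moreover have "0 \<le> s\<^sup>2" "0 \<le> s\<^sup>2 * s\<^sup>2" by simp_all
  ultimately show ?thesis by (simp only: distrib_left mult_1_right)
qed

lemma has_integral_inverse_one_plus_square:
  "has_bochner_integral half_line (\<lambda>s. 1 / (1 + s\<^sup>2)) (pi / 2)"
  using has_integral_cube_over_square_sum[of 1] by simp

text \<open>
The weight \<open>s\<^sup>2 \<bar>cot (\<pi> z) + i\<bar>\<close> is integrable uniformly in \<open>x\<close>, so bounds on the other factor carry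
over to the integral.
\<close>

lemma remainder_integral_bound:
  assumes b: "\<And>s. s > 0 \<Longrightarrow> norm (b s) \<le> B"
    and int: "integrable half_line (\<lambda>s. s\<^sup>2 * Im ((cot (of_real pi * Complex x s) + \<i>) * b s))"
  shows "\<bar>\<integral>s. s\<^sup>2 * Im ((cot (of_real pi * Complex x s) + \<i>) * b s) \<partial>half_line\<bar> \<le> pi * B"
proof -
  have le: "\<bar>s\<^sup>2 * Im ((cot (of_real pi * Complex x s) + \<i>) * b s)\<bar> \<le> 2 * B * (1 / (1 + s\<^sup>2))" if s: "s > 0" for s
  proof -
    define E where "E = exp (2 * pi * s) - 1"
    have E: "s\<^sup>2 * (1 + s\<^sup>2) \<le> E" "E > 0" using exp_minus_one_lower[OF s] s by (simp_all add: E_def)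
    have p: "1 + s\<^sup>2 > 0" by (simp add: add_pos_nonneg)
    have "\<bar>Im ((cot (of_real pi * Complex x s) + \<i>) * b s)\<bar> \<le> norm ((cot (of_real pi * Complex x s) + \<i>) * b s)"
      by (rule abs_Im_le_cmod)
    also have "\<dots> \<le> 2 / E * B"
      unfolding norm_mult using norm_cot_plus_ii_le[of "Complex x s"] s b[OF s] E(2)
      by (intro mult_mono) (auto simp: E_def)
    finally have "s\<^sup>2 * \<bar>Im ((cot (of_real pi * Complex x s) + \<i>) * b s)\<bar> \<le> s\<^sup>2 * (2 / E * B)"
      by (intro mult_left_mono) auto
    also have "\<dots> = 2 * B * (s\<^sup>2 / E)" by simp
    also have "\<dots> \<le> 2 * B * (1 / (1 + s\<^sup>2))"
    proof (intro mult_left_mono)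
      show "s\<^sup>2 / E \<le> 1 / (1 + s\<^sup>2)" using E p by (simp add: field_simps)
      show "0 \<le> 2 * B" using order_trans[OF norm_ge_zero b[OF s]] by simp
    qed
    finally show ?thesis by (simp only: abs_mult abs_power2)
  qed
  have g: "has_bochner_integral half_line (\<lambda>s. 2 * B * (1 / (1 + s\<^sup>2))) (2 * B * (pi / 2))"
    by (intro has_bochner_integral_mult_right has_integral_inverse_one_plus_square)
  have "\<bar>\<integral>s. s\<^sup>2 * Im ((cot (of_real pi * Complex x s) + \<i>) * b s) \<partial>half_line\<bar>
      \<le> (\<integral>s. \<bar>s\<^sup>2 * Im ((cot (of_real pi * Complex x s) + \<i>) * b s)\<bar> \<partial>half_line)"
    by (rule integral_abs_bound)
  also have "\<dots> \<le> (\<integral>s. 2 * B * (1 / (1 + s\<^sup>2)) \<partial>half_line)"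
    using int g le by (intro integral_mono) (auto simp: has_bochner_integral_iff space_restrict_space)
  also have "\<dots> = pi * B"
    using has_bochner_integral_integral_eq[OF g] by simp
  finally show ?thesis .
qed


lemma remainder_decay:
  assumes r: "r > 0" "\<bar>x\<bar> \<ge> r + 3/2"
  shows "\<bar>cot_remainder x\<bar> \<le> pi * (6 / r ^ 4)"
  unfolding cot_remainder_def
  by (intro remainder_integral_bound lagrange_integral_split norm_third_diff_inverse_le) (use r in simp_all)

text \<open>
By periodicity all shifts of the remainder share the factor \<open>cot (\<pi> z) + i\<close>, so that a weighted sum
of shifts is again an integral to which the preceding bound applies.
\<close>

lemma remainder_window:
  fixes c :: "int \<Rightarrow> real"
  assumes B: "\<And>s. s > 0 \<Longrightarrow> norm (\<Sum>k=-int N..int N. of_real (c k) * third_diff inverse (Complex x s - of_int k)) \<le> B"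
  shows "\<bar>\<Sum>k=-int N..int N. c k * cot_remainder (x - of_int k)\<bar> \<le> pi * B"
proof -
  let ?b = "\<lambda>s. \<Sum>k=-int N..int N. of_real (c k) * third_diff inverse (Complex x s - of_int k)"
  let ?h = "\<lambda>k s. s\<^sup>2 * Im ((cot (of_real pi * Complex (x - of_int k) s) + \<i>) * third_diff inverse (Complex (x - of_int k) s))"
  have shift: "Complex (x - of_int k) s = Complex x s - of_int k" for k s
    by (simp add: complex_eq_iff)
  have h: "s\<^sup>2 * Im ((cot (of_real pi * Complex x s) + \<i>) * ?b s) = (\<Sum>k=-int N..int N. c k * ?h k s)" for s
    unfolding shift cot_minus_int_period sum_distrib_left Im_sum
    by (intro sum.cong refl) (simp add: algebra_simps)
  have int: "integrable half_line (\<lambda>s. \<Sum>k=-int N..int N. c k * ?h k s)"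
    by (intro Bochner_Integration.integrable_sum integrable_mult_right lagrange_integral_split)
  have "(\<Sum>k=-int N..int N. c k * cot_remainder (x - of_int k)) = (\<integral>s. (\<Sum>k=-int N..int N. c k * ?h k s) \<partial>half_line)"
    unfolding cot_remainder_def
    by (subst Bochner_Integration.integral_sum)
      (auto intro!: integrable_mult_right lagrange_integral_split simp del: times_complex.simps)
  also have "\<bar>\<dots>\<bar> \<le> pi * B"
    using remainder_integral_bound[of ?b B x] B int unfolding h by blast
  finally show ?thesis .
qed

text \<open>
Both sums of third differences telescope, and the boundary terms sit at horizontal distance about
\<open>N\<close> from the poles.
\<close>

lemma remainder_window_bounds:
  assumes N: "real N \<ge> \<bar>x\<bar> + 2"
  defines "r \<equiv> real N - \<bar>x\<bar> - 1"
  shows "\<bar>\<Sum>k=-int N..int N. cot_remainder (x - of_int k)\<bar> \<le> pi * (4 / r\<^sup>2)"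
    and "\<bar>\<Sum>k=-int N..int N. (x - of_int k) * cot_remainder (x - of_int k)\<bar> \<le> pi * (10 / r\<^sup>2)"
proof -
  have r: "r \<ge> 1" using N by (simp add: r_def)
  define v where "v s = Complex x s + of_nat N + 1/2" for s
  define w where "w s = Complex x s - of_nat N - 1/2" for s
  have re: "\<bar>Re (v s)\<bar> \<ge> r + 1" "\<bar>Re (w s)\<bar> \<ge> r + 1" and im: "Im (v s) = s" "Im (w s) = s" for s
    using N by (auto simp: v_def w_def r_def)
  have sum0: "(\<Sum>k=-int N..int N. third_diff inverse (Complex x s - of_int k))
      = second_diff inverse (v s) - second_diff inverse (w s)" for s
    unfolding third_diff_window v_def w_def ..
  have "norm (\<Sum>k=-int N..int N. of_real 1 * third_diff inverse (Complex x s - of_int k)) \<le> 4 / r\<^sup>2" for s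
  proof -
    have "norm (second_diff inverse (v s) - second_diff inverse (w s)) \<le> 2 / r\<^sup>2 + 2 / r\<^sup>2"
      using norm_triangle_ineq4 norm_differences_of_inverse_le(1)[OF r re(1)] norm_differences_of_inverse_le(1)[OF r re(2)]
      by (rule order_trans[OF _ add_mono])
    then show ?thesis by (simp add: sum0)
  qed
  from remainder_window[where c = "\<lambda>_. 1", OF this]
  show "\<bar>\<Sum>k=-int N..int N. cot_remainder (x - of_int k)\<bar> \<le> pi * (4 / r\<^sup>2)" by simp
  have "norm (\<Sum>k=-int N..int N. of_real (x - of_int k) * third_diff inverse (Complex x s - of_int k)) \<le> 10 / r\<^sup>2"
    if s: "s > 0" for s
  proof -
    (* Passing from the real weight to the complex one makes the sum telescope, at the cost
    of a multiple of s. *)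
    have "of_real (x - of_int k) = Complex x s - of_int k - \<i> * of_real s" for k
      by (simp add: complex_eq_iff)
    then have "(\<Sum>k=-int N..int N. of_real (x - of_int k) * third_diff inverse (Complex x s - of_int k))
       = (\<Sum>k=-int N..int N. (Complex x s - of_int k) * third_diff inverse (Complex x s - of_int k))
         - \<i> * of_real s * (\<Sum>k=-int N..int N. third_diff inverse (Complex x s - of_int k))"
      by (simp only: left_diff_distrib sum_subtractf sum_distrib_left)
    also have "\<dots> = (moment_diff inverse (v s) - moment_diff inverse (w s))
        - (\<i> * of_real s * second_diff inverse (v s) - \<i> * of_real s * second_diff inverse (w s))"
      unfolding sum0 third_diff_moment_window v_def w_def by (simp only: right_diff_distrib)
    also have "norm \<dots> \<le> (3 / r\<^sup>2 + 3 / r\<^sup>2) + (2 / r\<^sup>2 + 2 / r\<^sup>2)"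
    proof (intro order_trans[OF norm_triangle_ineq4 add_mono])
      show "norm (\<i> * of_real s * second_diff inverse (v s)) \<le> 2 / r\<^sup>2"
        using norm_differences_of_inverse_le(2)[OF r re(1)] im by (simp add: norm_mult)
      show "norm (\<i> * of_real s * second_diff inverse (w s)) \<le> 2 / r\<^sup>2"
        using norm_differences_of_inverse_le(2)[OF r re(2)] im by (simp add: norm_mult)
    qed (intro norm_differences_of_inverse_le r re)+
    finally show ?thesis by simp
  qed
  from remainder_window[OF this]
  show "\<bar>\<Sum>k=-int N..int N. (x - of_int k) * cot_remainder (x - of_int k)\<bar> \<le> pi * (10 / r\<^sup>2)" .
qed

section \<open>Reproduction of linear polynomials\<close>

text \<open>
Away from the origin \<open>y \<bar>y\<bar>\<close> is quadratic on either side. The jump of its second difference from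
\<open>-2\<close> to \<open>2\<close> is the total mass 4 of the spline.
\<close>

lemma spline_differences:
  fixes v :: real
  shows "v \<ge> 1 \<Longrightarrow> second_diff (\<lambda>y. y * \<bar>y\<bar>) v = 2" "v \<le> -1 \<Longrightarrow> second_diff (\<lambda>y. y * \<bar>y\<bar>) v = -2"
    "\<bar>v\<bar> \<ge> 1 \<Longrightarrow> moment_diff (\<lambda>y. y * \<bar>y\<bar>) v = 0"
proof -
  show 1: "second_diff (\<lambda>y. y * \<bar>y\<bar>) v = 2" if "v \<ge> 1"
    unfolding second_diff_def using that by (simp add: algebra_simps)
  show 2: "second_diff (\<lambda>y. y * \<bar>y\<bar>) v = -2" if "v \<le> -1"
    unfolding second_diff_def using that by (simp add: algebra_simps)
  show "moment_diff (\<lambda>y. y * \<bar>y\<bar>) v = 0" if "\<bar>v\<bar> \<ge> 1"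
  proof (cases "v \<ge> 1")
    case True
    then show ?thesis unfolding moment_diff_def 1[OF True] by (simp add: field_simps)
  next
    case False
    then have le: "v \<le> -1" using that by linarith
    then show ?thesis unfolding moment_diff_def 2[OF le] by (simp add: field_simps)
  qed
qed

lemma third_diff_spline_eq_0:
  fixes x :: real
  assumes "\<bar>x\<bar> \<ge> 3/2"
  shows "third_diff (\<lambda>y. y * \<bar>y\<bar>) x = 0"
  using assms unfolding third_diff_def by (cases "x \<ge> 0") (simp_all add: algebra_simps)

lemma lagrange_integral_tail:
  assumes "\<bar>u\<bar> \<ge> 2"
  shows "\<bar>lagrange_integral u\<bar> \<le> 3 / (\<bar>u\<bar> - 3/2) ^ 4"
proof -
  have "third_diff (\<lambda>y. y * \<bar>y\<bar>) u = 0" using assms by (intro third_diff_spline_eq_0) linarith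
  then have "\<bar>lagrange_integral u\<bar> = \<bar>cot_remainder u\<bar> / (2 * pi)"
    unfolding lagrange_integral_split(2) by (simp add: abs_mult)
  also have "\<dots> \<le> pi * (6 / (\<bar>u\<bar> - 3/2) ^ 4) / (2 * pi)"
    by (intro divide_right_mono remainder_decay) (use assms in simp_all)
  also have "\<dots> = 3 / (\<bar>u\<bar> - 3/2) ^ 4" by simp
  finally show ?thesis .
qed

lemma lagrange_integral_shifts_summable:
  "(\<lambda>k::int. lagrange_integral (x - of_int k)) summable_on UNIV"
  "(\<lambda>k::int. (x - of_int k) * lagrange_integral (x - of_int k)) summable_on UNIV"
proof -
  have *: "summable (\<lambda>n. norm (real n powr (-2)))"
    by (simp add: summable_real_powr_iff)
  have tail: "summable (\<lambda>n. c (u n) * lagrange_integral (u n))"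
    if c: "\<And>v. \<bar>c v\<bar> \<le> \<bar>v\<bar> + 1"
      and u: "\<forall>\<^sub>F n in sequentially. \<bar>u n\<bar> \<ge> 2"
      and O: "(\<lambda>n. (\<bar>u n\<bar> + 1) * (3 / (\<bar>u n\<bar> - 3/2) ^ 4)) \<in> O(\<lambda>n. real n powr (-2))"
    for c :: "real \<Rightarrow> real" and u :: "nat \<Rightarrow> real"
  proof (rule summable_comparison_test_ev)
    show "summable (\<lambda>n. (\<bar>u n\<bar> + 1) * (3 / (\<bar>u n\<bar> - 3/2) ^ 4))"
      by (rule summable_comparison_test_bigo[OF * O])
    show "\<forall>\<^sub>F n in sequentially. norm (c (u n) * lagrange_integral (u n)) \<le> (\<bar>u n\<bar> + 1) * (3 / (\<bar>u n\<bar> - 3/2) ^ 4)"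
      using u by eventually_elim (auto simp only: real_norm_def abs_mult intro!: mult_mono c lagrange_integral_tail)
  qed
  have ev: "\<forall>\<^sub>F n in sequentially. \<bar>x - real n\<bar> \<ge> 2" "\<forall>\<^sub>F n in sequentially. \<bar>x + real n\<bar> \<ge> 2"
    by real_asymp+
  have O: "(\<lambda>n. (\<bar>x - real n\<bar> + 1) * (3 / (\<bar>x - real n\<bar> - 3/2) ^ 4)) \<in> O(\<lambda>n. real n powr (-2))"
    "(\<lambda>n. (\<bar>x + real n\<bar> + 1) * (3 / (\<bar>x + real n\<bar> - 3/2) ^ 4)) \<in> O(\<lambda>n. real n powr (-2))"
    by real_asymp+
  have tails: "summable (\<lambda>n. \<bar>c (x - real n) * lagrange_integral (x - real n)\<bar>)"
    "summable (\<lambda>n. \<bar>c (x + real n) * lagrange_integral (x + real n)\<bar>)"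
    if "\<And>v. \<bar>c v\<bar> \<le> \<bar>v\<bar> + 1" for c :: "real \<Rightarrow> real"
  proof -
    have s: "\<bar>sgn (lagrange_integral v) * \<bar>c v\<bar>\<bar> \<le> \<bar>v\<bar> + 1" for v
      using that[of v] by (auto simp: abs_mult sgn_if)
    (* Multiplication by the sign turns the weighted value into its absolute value, so
    that summability of the products gives absolute summability. *)
    have e: "sgn (lagrange_integral v) * \<bar>c v\<bar> * lagrange_integral v = \<bar>c v * lagrange_integral v\<bar>" for v
      by (simp add: abs_mult sgn_if)
    show "summable (\<lambda>n. \<bar>c (x - real n) * lagrange_integral (x - real n)\<bar>)"
      using tail[of "\<lambda>v. sgn (lagrange_integral v) * \<bar>c v\<bar>", OF s ev(1) O(1)] unfolding e .
    show "summable (\<lambda>n. \<bar>c (x + real n) * lagrange_integral (x + real n)\<bar>)"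
      using tail[of "\<lambda>v. sgn (lagrange_integral v) * \<bar>c v\<bar>", OF s ev(2) O(2)] unfolding e .
  qed
  show "(\<lambda>k::int. lagrange_integral (x - of_int k)) summable_on UNIV"
    by (rule summable_on_int_if_summable_tails) (use tails[of "\<lambda>_. 1"] in simp_all)
  show "(\<lambda>k::int. (x - of_int k) * lagrange_integral (x - of_int k)) summable_on UNIV"
    by (rule summable_on_int_if_summable_tails) (use tails[of "\<lambda>v. v"] in simp_all)
qed

text \<open>
Over a sufficiently large window the B-spline contributes its exact moments 1 and 0, and the
remainder contributes an error of order \<open>N\<^sup>-\<^sup>2\<close>.
\<close>

lemma lagrange_integral_moments:
  shows "((\<lambda>k::int. lagrange_integral (x - of_int k)) has_sum 1) UNIV"
    and "((\<lambda>k::int. (x - of_int k) * lagrange_integral (x - of_int k)) has_sum 0) UNIV"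
proof -
  define R where "R c N = (\<Sum>k=-int N..int N. c (x - of_int k) * cot_remainder (x - of_int k)) / (2 * pi)"
    for c :: "real \<Rightarrow> real" and N
  have R_le: "\<bar>R c N\<bar> \<le> \<bar>\<Sum>k=-int N..int N. c (x - of_int k) * cot_remainder (x - of_int k)\<bar>" for c N
  proof -
    have "\<bar>t / (2 * pi)\<bar> \<le> \<bar>t\<bar>" for t
      using pi_gt3 mult_left_mono[of 1 "2 * pi" "\<bar>t\<bar>"] by (simp add: abs_mult divide_le_eq)
    then show ?thesis unfolding R_def .
  qed
  have large: "\<forall>\<^sub>F N in sequentially. real N \<ge> \<bar>x\<bar> + 2" by real_asymp
  have "R (\<lambda>_. 1) \<longlonglongrightarrow> 0"
  proof (rule Lim_null_comparison)
    show "\<forall>\<^sub>F N in sequentially. norm (R (\<lambda>_. 1) N) \<le> pi * (4 / (real N - \<bar>x\<bar> - 1)\<^sup>2)"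
      using large
    proof eventually_elim
      case (elim N)
      show ?case
        using remainder_window_bounds(1)[OF elim] R_le[of "\<lambda>_. 1" N] by simp
    qed
    show "(\<lambda>N. pi * (4 / (real N - \<bar>x\<bar> - 1)\<^sup>2)) \<longlonglongrightarrow> 0" by real_asymp
  qed
  then have "(\<lambda>N. 1 + R (\<lambda>_. 1) N) \<longlonglongrightarrow> 1"
    using tendsto_add[OF tendsto_const[of 1]] by fastforce
  moreover have "\<forall>\<^sub>F N in sequentially. (\<Sum>k=-int N..int N. lagrange_integral (x - of_int k)) = 1 + R (\<lambda>_. 1) N"
    using large
  proof eventually_elim
    case (elim N)
    have "(\<Sum>k=-int N..int N. third_diff (\<lambda>y. y * \<bar>y\<bar>) (x - of_int k)) = 4"
      unfolding third_diff_window using elim by (subst spline_differences(1), simp, subst spline_differences(2)) simp_all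
    then show ?case
      unfolding lagrange_integral_split(2) R_def sum.distrib by (simp flip: sum_divide_distrib)
  qed
  ultimately have "(\<lambda>N. \<Sum>k=-int N..int N. lagrange_integral (x - of_int k)) \<longlonglongrightarrow> 1"
    by (subst tendsto_cong)
  then show "((\<lambda>k::int. lagrange_integral (x - of_int k)) has_sum 1) UNIV"
    by (intro has_sum_int_window_limit lagrange_integral_shifts_summable)
  have "R (\<lambda>v. v) \<longlonglongrightarrow> 0"
  proof (rule Lim_null_comparison)
    show "\<forall>\<^sub>F N in sequentially. norm (R (\<lambda>v. v) N) \<le> pi * (10 / (real N - \<bar>x\<bar> - 1)\<^sup>2)"
      using large
    proof eventually_elim
      case (elim N)
      show ?case
        using remainder_window_bounds(2)[OF elim] R_le[of "\<lambda>v. v" N] by simp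
    qed
    show "(\<lambda>N. pi * (10 / (real N - \<bar>x\<bar> - 1)\<^sup>2)) \<longlonglongrightarrow> 0" by real_asymp
  qed
  moreover have "\<forall>\<^sub>F N in sequentially. (\<Sum>k=-int N..int N. (x - of_int k) * lagrange_integral (x - of_int k)) = R (\<lambda>v. v) N"
    using large
  proof eventually_elim
    case (elim N)
    have "(\<Sum>k=-int N..int N. (x - of_int k) * third_diff (\<lambda>y. y * \<bar>y\<bar>) (x - of_int k)) = 0"
      unfolding third_diff_moment_window using elim by (subst spline_differences(3), simp, subst spline_differences(3)) simp_all
    then show ?case
      unfolding lagrange_integral_split(2) R_def distrib_left sum.distrib times_divide_eq_right sum_divide_distrib[symmetric] by simp
  qed
  ultimately have "(\<lambda>N. \<Sum>k=-int N..int N. (x - of_int k) * lagrange_integral (x - of_int k)) \<longlonglongrightarrow> 0"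
    by (subst tendsto_cong)
  then show "((\<lambda>k::int. (x - of_int k) * lagrange_integral (x - of_int k)) has_sum 0) UNIV"
    by (intro has_sum_int_window_limit lagrange_integral_shifts_summable)
qed

theorem theorem2:
  fixes p :: "complex poly" and x :: real
  assumes "degree p \<le> 1"
  shows "((\<lambda>k::int. poly p (of_int k) * quasi_lagrange (x - of_int k))
           has_sum poly p (of_real x)) UNIV"
proof -
  define a b where "a = coeff p 0" and "b = coeff p 1"
  have p: "poly p z = a + b * z" for z
    using assms unfolding poly_altdef a_def b_def
    by (cases "degree p") (auto simp: coeff_eq_0)
  have "((\<lambda>k::int. (a + b * of_real x) * of_real (lagrange_integral (x - of_int k))
           + (- b) * of_real ((x - of_int k) * lagrange_integral (x - of_int k)))
         has_sum ((a + b * of_real x) * of_real 1 + (- b) * of_real 0)) UNIV"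
    by (intro has_sum_add has_sum_cmult_right has_sum_of_real lagrange_integral_moments)
  moreover have "(a + b * of_real x) * of_real (lagrange_integral (x - of_int k))
           + (- b) * of_real ((x - of_int k) * lagrange_integral (x - of_int k))
      = poly p (of_int k) * quasi_lagrange (x - of_int k)" for k :: int
    unfolding p quasi_lagrange_eq_lagrange_integral(2) by (simp add: algebra_simps)
  ultimately show ?thesis
    by (simp add: p)
qed

end
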